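(* The total curvature of the central path of the linear programs $\mathrm{LW}_r(t)$ is exponential in $r$, provided that $t>0$ is sufficiently large.
   Context: The linear program. For an integer $r\ge1$ and a real parameter $t>0$, $\mathrm{LW}_r(t)$ is the linear program with $2r$ variables and $3r+1$ constraints: minimize $x_1$ subject to $x_1\le t^2$, $x_2\le t$, and, for $1\le j<r$, $x_{2j+1}\le t\,x_{2j-1}$, $x_{2j+1}\le t\,x_{2j}$, $x_{2j+2}\le t^{1-1/2^j}(x_{2j-1}+x_{2j})$, and $x_{2r-1}\ge0$, $x_{2r}\ge0$. Slack form. Introducing slack variables $w_1,\dots,w_{3r-1}$ in the first $3r-1$ inequalities (all except the last two, which are nonnegativity constraints), and adding the redundant inequalities $x_i\ge0$ for $1\le i<2r-1$, one writes this linear program in the form: minimize $\langle c,x\rangle$ subject to $Ax+w=b$, $(x,w)\in\mathbb{R}_+^{n+m}$, with $n=2r$, $m=3r-1$, where $A\in\mathbb{R}^{m\times n}$, $b\in\mathbb{R}^m$, $c\in\mathbb{R}^n$ depend on $r$ and $t$. The central path of $\mathrm{LW}_r(t)$ is understood with respect to this form. Central path. For a linear program of this form for which there exist $x,w,s,y>0$ with $Ax+w=b$ and $s-A^\top y=c$, and for each real $\mu>0$, the system $Ax+w=b$, $s-A^\top y=c$, $x_js_j=\mu$ for all $j\in[n]$, $w_iy_i=\mu$ for all $i\in[m]$, $x,w,s,y>0$ has a unique solution $(x^\mu,w^\mu,s^\mu,y^\mu)\in\mathbb{R}^{2(n+m)}$. The central path is the map $\mu\mapsto(x^\mu,w^\mu,s^\mu,y^\mu)$,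 $\mu>0$; its projection $\mu\mapsto(x^\mu,w^\mu)$ is the primal central path. Total curvature. For nonzero $u,v\in\mathbb{R}^d$, the angle between them is the $\alpha\in[0,\pi]$ with $\cos\alpha=\langle u,v\rangle/(\|u\|\|v\|)$ (Euclidean norm). The total curvature of a polygonal curve is the sum of the angles between its consecutive segments. The total curvature of an arbitrary parameterized curve is the supremum of the total curvatures of the polygonal curves inscribed in it. *)

theory Defs
  imports Complex_Main "HOL-Library.Extended_Real" "Jordan_Normal_Form.Matrix"
begin

section \<open>Central path\<close>

text \<open>Linear programs \<open>min c \<bullet> x\<close> subject to \<open>A x + w = b\<close>, \<open>x, w \<ge> 0\<close>, with \<open>A\<close> of
  size \<open>m \<times> n\<close>.\<close>

definition central_path_system ::
    "real mat \<Rightarrow> real vec \<Rightarrow> real vec \<Rightarrow> real \<Rightarrow> real vec \<Rightarrow> real vec \<Rightarrow> real vec \<Rightarrow> real vec \<Rightarrow> bool" where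
  "central_path_system A b c \<mu> x w s y \<longleftrightarrow>
     x \<in> carrier_vec (dim_col A) \<and> w \<in> carrier_vec (dim_row A) \<and>
     s \<in> carrier_vec (dim_col A) \<and> y \<in> carrier_vec (dim_row A) \<and>
     A *\<^sub>v x + w = b \<and> s - transpose_mat A *\<^sub>v y = c \<and>
     (\<forall>j<dim_col A. x $ j * s $ j = \<mu>) \<and> (\<forall>i<dim_row A. w $ i * y $ i = \<mu>) \<and>
     (\<forall>j<dim_col A. x $ j > 0 \<and> s $ j > 0) \<and> (\<forall>i<dim_row A. w $ i > 0 \<and> y $ i > 0)"

text \<open>The primal-dual point \<open>(x, w, s, y)\<close> as one vector of dimension \<open>2 (n + m)\<close>. The description
  is proper when \<open>\<mu> > 0\<close> and primal and dual both have strictly feasible points.\<close>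

definition central_path :: "real mat \<Rightarrow> real vec \<Rightarrow> real vec \<Rightarrow> real \<Rightarrow> real vec" where
  "central_path A b c \<mu> =
     (THE z. \<exists>x w s y. central_path_system A b c \<mu> x w s y \<and> z = x @\<^sub>v w @\<^sub>v s @\<^sub>v y)"

section \<open>Total curvature\<close>

definition vec_angle :: "real vec \<Rightarrow> real vec \<Rightarrow> real" where
  "vec_angle u v = arccos ((u \<bullet> v) / (sqrt (u \<bullet> u) * sqrt (v \<bullet> v)))"

definition polygon_curvature :: "real vec list \<Rightarrow> real" where
  "polygon_curvature ps =
     (\<Sum>i<length ps - 2. vec_angle (ps ! (i + 1) - ps ! i) (ps ! (i + 2) - ps ! (i + 1)))"

text \<open>Consecutive vertices of an inscribed polygonal curve are required to be distinct, since
  angles are meaningful for nonzero segments only (and \<open>vec_angle\<close> would return \<open>\<pi> / 2\<close>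
  on a zero segment).\<close>

definition inscribed_polygons :: "real set \<Rightarrow> (real \<Rightarrow> real vec) \<Rightarrow> real vec list set" where
  "inscribed_polygons I \<gamma> =
     {map \<gamma> \<tau> | \<tau>. set \<tau> \<subseteq> I \<and> sorted_wrt (<) \<tau> \<and>
        (\<forall>i. i + 1 < length \<tau> \<longrightarrow> \<gamma> (\<tau> ! i) \<noteq> \<gamma> (\<tau> ! (i + 1)))}"

definition total_curvature :: "real set \<Rightarrow> (real \<Rightarrow> real vec) \<Rightarrow> ereal" where
  "total_curvature I \<gamma> = (SUP ps \<in> inscribed_polygons I \<gamma>. ereal (polygon_curvature ps))"

section \<open>The linear programs \<open>LW\<^sub>r(t)\<close>\<close>

text \<open>The defining inequalities, with the variables numbered from 1.\<close>

definition lw_feasible :: "nat \<Rightarrow> real \<Rightarrow> (nat \<Rightarrow> real) \<Rightarrow> bool" where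
  "lw_feasible r t X \<longleftrightarrow>
     X 1 \<le> t ^ 2 \<and> X 2 \<le> t \<and>
     (\<forall>j. 1 \<le> j \<and> j < r \<longrightarrow>
        X (2 * j + 1) \<le> t * X (2 * j - 1) \<and>
        X (2 * j + 1) \<le> t * X (2 * j) \<and>
        X (2 * j + 2) \<le> t powr (1 - 1 / 2 ^ j) * (X (2 * j - 1) + X (2 * j))) \<and>
     X (2 * r - 1) \<ge> 0 \<and> X (2 * r) \<ge> 0"

text \<open>Slack form. Rows and columns are numbered from 0, so column \<open>k\<close> belongs to \<open>X (k + 1)\<close>. Rows
  0 and 1 are the two upper bounds, and rows \<open>3 j - 1\<close>, \<open>3 j\<close>, \<open>3 j + 1\<close> are the three
  inequalities with index \<open>j\<close>, in the order above.\<close>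

definition lw_A :: "nat \<Rightarrow> real \<Rightarrow> real mat" where
  "lw_A r t = mat (3 * r - 1) (2 * r) (\<lambda>(i, k).
     if i < 2 then (if k = i then 1 else 0)
     else let j = (i + 1) div 3 in
       if i = 3 * j - 1 then (if k = 2 * j then 1 else if k = 2 * j - 2 then - t else 0)
       else if i = 3 * j then (if k = 2 * j then 1 else if k = 2 * j - 1 then - t else 0)
       else (if k = 2 * j + 1 then 1
             else if k = 2 * j - 2 \<or> k = 2 * j - 1 then - (t powr (1 - 1 / 2 ^ j)) else 0))"

definition lw_b :: "nat \<Rightarrow> real \<Rightarrow> real vec" where
  "lw_b r t = vec (3 * r - 1) (\<lambda>i. if i = 0 then t ^ 2 else if i = 1 then t else 0)"

definition lw_c :: "nat \<Rightarrow> real vec" where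
  "lw_c r = unit_vec (2 * r) 0"

definition lw_central_path :: "nat \<Rightarrow> real \<Rightarrow> real \<Rightarrow> real vec" where
  "lw_central_path r t = central_path (lw_A r t) (lw_b r t) (lw_c r)"

lemma lw_objective: "r \<ge> 1 \<Longrightarrow> x \<in> carrier_vec (2 * r) \<Longrightarrow> lw_c r \<bullet> x = x $ 0"
  by (simp add: lw_c_def)

lemma lw_row:
  assumes r: "r \<ge> 1" and x: "x \<in> carrier_vec (2 * r)"
  shows "(lw_A r t *\<^sub>v x) $ 0 = x $ 0"
    and "(lw_A r t *\<^sub>v x) $ 1 = x $ 1"
    and "1 \<le> j \<Longrightarrow> j < r \<Longrightarrow> (lw_A r t *\<^sub>v x) $ (3 * j - 1) = x $ (2 * j) - t * x $ (2 * j - 2)"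
    and "1 \<le> j \<Longrightarrow> j < r \<Longrightarrow> (lw_A r t *\<^sub>v x) $ (3 * j) = x $ (2 * j) - t * x $ (2 * j - 1)"
    and "1 \<le> j \<Longrightarrow> j < r \<Longrightarrow> (lw_A r t *\<^sub>v x) $ (3 * j + 1) =
           x $ (2 * j + 1) - t powr (1 - 1 / 2 ^ j) * (x $ (2 * j - 2) + x $ (2 * j - 1))"
proof -
  have gen: "(lw_A r t *\<^sub>v x) $ i = (\<Sum>k\<in>{0..<2 * r}. lw_A r t $$ (i, k) * x $ k)"
    if "i < 3 * r - 1" for i
    using that x by (auto simp: lw_A_def scalar_prod_def intro!: sum.cong)
  have pick: "(\<Sum>k\<in>{0..<2 * r}. f k * x $ k) = (\<Sum>k\<in>S. f k * x $ k)"
    if "S \<subseteq> {0..<2 * r}" "\<And>k. k < 2 * r \<Longrightarrow> k \<notin> S \<Longrightarrow> f k = 0" for f :: "nat \<Rightarrow> real" and S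
    using that by (intro sum.mono_neutral_right) auto
  show "(lw_A r t *\<^sub>v x) $ 0 = x $ 0"
    using r by (subst gen, simp, subst pick[where S = "{0}"]) (auto simp: lw_A_def)
  show "(lw_A r t *\<^sub>v x) $ 1 = x $ 1"
  proof -
    have "1 < 3 * r - 1" using r by linarith
    then show ?thesis
      using r by (subst gen, simp, subst pick[where S = "{1}"]) (auto simp: lw_A_def)
  qed
  assume j: "1 \<le> j" "j < r"
  have d: "(3 * j - 1 + 1) div 3 = j" "(3 * j + 1) div 3 = j" "(3 * j + 1 + 1) div 3 = j"
    using j by auto
  have n: "\<not> 3 * j - 1 < 2" "\<not> 3 * j < 2" "\<not> 3 * j + 1 < 2" "3 * j \<noteq> 3 * j - 1"
    "3 * j + 1 \<noteq> 3 * j - 1" "3 * j + 1 \<noteq> 3 * j"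
    "2 * j \<noteq> 2 * j - 2" "2 * j \<noteq> 2 * j - 1" "2 * j + 1 \<noteq> 2 * j - 2" "2 * j + 1 \<noteq> 2 * j - 1"
    "2 * j - 2 \<noteq> 2 * j - 1"
    using j by auto
  have b: "3 * j - 1 < 3 * r - 1" "3 * j < 3 * r - 1" "3 * j + 1 < 3 * r - 1"
    "2 * j < 2 * r" "2 * j + 1 < 2 * r" "2 * j - 1 < 2 * r" "2 * j - 2 < 2 * r"
    using j by auto
  have e1: "lw_A r t $$ (3 * j - 1, k) =
      (if k = 2 * j then 1 else if k = 2 * j - 2 then - t else 0)" if "k < 2 * r" for k
    unfolding lw_A_def index_mat(1)[OF b(1) that] prod.case Let_def d using n(1) by simp
  have e2: "lw_A r t $$ (3 * j, k) =
      (if k = 2 * j then 1 else if k = 2 * j - 1 then - t else 0)" if "k < 2 * r" for k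
    unfolding lw_A_def index_mat(1)[OF b(2) that] prod.case Let_def d using n(2,4) by simp
  have e3: "lw_A r t $$ (3 * j + 1, k) = (if k = 2 * j + 1 then 1
      else if k = 2 * j - 2 \<or> k = 2 * j - 1 then - (t powr (1 - 1 / 2 ^ j)) else 0)"
    if "k < 2 * r" for k
    unfolding lw_A_def index_mat(1)[OF b(3) that] prod.case Let_def d using n(3,5,6) by simp
  have sum2: "(\<Sum>k\<in>{0..<2 * r}. g k * x $ k) = \<alpha> * x $ p + \<beta> * x $ q"
    if "p < 2 * r" "q < 2 * r" "p \<noteq> q"
      "\<And>k. k < 2 * r \<Longrightarrow> g k = (if k = p then \<alpha> else if k = q then \<beta> else 0)" for g p q \<alpha> \<beta>
  proof -
    have "(\<Sum>k\<in>{0..<2 * r}. g k * x $ k) = (\<Sum>k\<in>{p, q}. g k * x $ k)"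
      by (rule pick) (use that in auto)
    then show ?thesis using that by simp
  qed
  show "(lw_A r t *\<^sub>v x) $ (3 * j - 1) = x $ (2 * j) - t * x $ (2 * j - 2)"
    using sum2[OF b(4,7) n(7) e1] unfolding gen[OF b(1)] by simp
  show "(lw_A r t *\<^sub>v x) $ (3 * j) = x $ (2 * j) - t * x $ (2 * j - 1)"
    using sum2[OF b(4,6) n(8) e2] unfolding gen[OF b(2)] by simp
  have "(\<Sum>k\<in>{0..<2 * r}. lw_A r t $$ (3 * j + 1, k) * x $ k) =
      (\<Sum>k\<in>{2 * j + 1, 2 * j - 2, 2 * j - 1}. lw_A r t $$ (3 * j + 1, k) * x $ k)"
  proof (rule pick)
    show "{2 * j + 1, 2 * j - 2, 2 * j - 1} \<subseteq> {0..<2 * r}" using b(5-7) by simp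
    show "lw_A r t $$ (3 * j + 1, k) = 0"
      if "k < 2 * r" "k \<notin> {2 * j + 1, 2 * j - 2, 2 * j - 1}" for k
      using that(2) unfolding e3[OF that(1)] by simp
  qed
  also have "\<dots> = x $ (2 * j + 1) - t powr (1 - 1 / 2 ^ j) * (x $ (2 * j - 2) + x $ (2 * j - 1))"
    using n(9,10,11) e3[OF b(5)] e3[OF b(6)] e3[OF b(7)] by (simp add: algebra_simps)
  finally show "(lw_A r t *\<^sub>v x) $ (3 * j + 1) =
      x $ (2 * j + 1) - t powr (1 - 1 / 2 ^ j) * (x $ (2 * j - 2) + x $ (2 * j - 1))"
    unfolding gen[OF b(3)] .
qed

lemma lw_feasible_nonneg:
  assumes t: "t > 0" and f: "lw_feasible r t X" and k: "1 \<le> k" "k \<le> 2 * r"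
  shows "X k \<ge> 0"
proof -
  have last: "X (2 * r - 1) \<ge> 0" "X (2 * r) \<ge> 0"
    using f unfolding lw_feasible_def by blast+
  have ineq: "X (2 * j + 1) \<le> t * X (2 * j - 1) \<and> X (2 * j + 1) \<le> t * X (2 * j)"
      if "1 \<le> j" "j < r" for j
    using f that unfolding lw_feasible_def by blast
  have *: "1 \<le> j \<Longrightarrow> X (2 * j - 1) \<ge> 0 \<and> X (2 * j) \<ge> 0" if "j \<le> r" for j
    using that
  proof (induction rule: inc_induct)
    case base
    then show ?case using last by blast
  next
    case (step j)
    then have "X (2 * j + 1) \<ge> 0" by simp
    then have "0 \<le> t * X (2 * j - 1)" "0 \<le> t * X (2 * j)"
      using ineq[OF step.prems step.hyps(2)] by linarith+
    then show ?case using t by (simp add: zero_le_mult_iff)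
  qed
  show ?thesis
  proof (cases "even k")
    case True
    then obtain j where "k = 2 * j" by (elim evenE)
    then show ?thesis using *[of j] k by simp
  next
    case False
    then obtain j where "k = 2 * j + 1" by (elim oddE)
    then show ?thesis using *[of "j + 1"] k by simp
  qed
qed

lemma lw_slack_form:
  assumes r: "r \<ge> 1" and t: "t > 0" and x: "x \<in> carrier_vec (2 * r)"
  shows "lw_feasible r t (\<lambda>k. x $ (k - 1)) \<longleftrightarrow>
    (\<exists>w \<in> carrier_vec (3 * r - 1). lw_A r t *\<^sub>v x + w = lw_b r t \<and>
       (\<forall>j<2 * r. x $ j \<ge> 0) \<and> (\<forall>i<3 * r - 1. w $ i \<ge> 0))"
    (is "?L \<longleftrightarrow> ?R")
proof -
  define B where "B = lw_A r t *\<^sub>v x"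
  have dB: "dim_vec B = 3 * r - 1" by (simp add: B_def lw_A_def)
  have row: "B $ 0 = x $ 0" "B $ 1 = x $ 1"
    "\<And>j. 1 \<le> j \<Longrightarrow> j < r \<Longrightarrow> B $ (3 * j - 1) = x $ (2 * j) - t * x $ (2 * j - 2)"
    "\<And>j. 1 \<le> j \<Longrightarrow> j < r \<Longrightarrow> B $ (3 * j) = x $ (2 * j) - t * x $ (2 * j - 1)"
    "\<And>j. 1 \<le> j \<Longrightarrow> j < r \<Longrightarrow> B $ (3 * j + 1) =
           x $ (2 * j + 1) - t powr (1 - 1 / 2 ^ j) * (x $ (2 * j - 2) + x $ (2 * j - 1))"
    unfolding B_def using lw_row[OF r x] by blast+
  have ex: "(\<exists>w \<in> carrier_vec (3 * r - 1). B + w = lw_b r t \<and> P \<and> (\<forall>i<3 * r - 1. w $ i \<ge> 0))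
      \<longleftrightarrow> (\<forall>i<3 * r - 1. B $ i \<le> lw_b r t $ i) \<and> P" for P
  proof (intro iffI, goal_cases)
    case 1
    then obtain w where w: "w \<in> carrier_vec (3 * r - 1)" "B + w = lw_b r t" P
      "\<forall>i<3 * r - 1. w $ i \<ge> 0" by blast
    have "B $ i \<le> lw_b r t $ i" if "i < 3 * r - 1" for i
      using that w(1,4) by (simp add: w(2)[symmetric])
    then show ?case using w(3) by blast
  next
    case 2
    have db: "dim_vec (lw_b r t) = 3 * r - 1" by (simp add: lw_b_def)
    have "B + (lw_b r t - B) = lw_b r t" by (rule eq_vecI) (use dB db in auto)
    moreover have "lw_b r t - B \<in> carrier_vec (3 * r - 1)"
      by (rule carrier_vecI) (use dB in simp)
    moreover have "\<forall>i<3 * r - 1. (lw_b r t - B) $ i \<ge> 0" using 2 dB by auto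
    ultimately show ?case using 2 by blast
  qed
  have all: "(\<forall>i<3 * r - 1. Q i) \<longleftrightarrow>
      Q 0 \<and> Q 1 \<and> (\<forall>j. 1 \<le> j \<and> j < r \<longrightarrow> Q (3 * j - 1) \<and> Q (3 * j) \<and> Q (3 * j + 1))" for Q
  proof (intro iffI, goal_cases)
    case 1
    then show ?case using r by auto
  next
    case 2
    show ?case
    proof (intro allI impI)
      fix i assume i: "i < 3 * r - 1"
      define j where "j = (i + 1) div 3"
      consider "i = 0" | "i = 1" | "i \<ge> 2" by linarith
      then show "Q i"
      proof cases
        case 3
        then have "1 \<le> j" "j < r" using i unfolding j_def by linarith+
        moreover have "i = 3 * j - 1 \<or> i = 3 * j \<or> i = 3 * j + 1"
          using 3 unfolding j_def by linarith
        ultimately show ?thesis using 2 by blast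
      qed (use 2 in auto)
    qed
  qed
  have bj: "lw_b r t $ 0 = t ^ 2" "lw_b r t $ 1 = t"
    "\<And>j. 1 \<le> j \<Longrightarrow> j < r \<Longrightarrow> lw_b r t $ (3 * j - 1) = 0 \<and> lw_b r t $ (3 * j) = 0 \<and>
      lw_b r t $ (3 * j + 1) = 0"
    using r by (auto simp: lw_b_def)
  have le: "(\<forall>i<3 * r - 1. B $ i \<le> lw_b r t $ i) \<longleftrightarrow>
      x $ 0 \<le> t ^ 2 \<and> x $ 1 \<le> t \<and> (\<forall>j. 1 \<le> j \<and> j < r \<longrightarrow>
        x $ (2 * j) \<le> t * x $ (2 * j - 2) \<and> x $ (2 * j) \<le> t * x $ (2 * j - 1) \<and>
        x $ (2 * j + 1) \<le> t powr (1 - 1 / 2 ^ j) * (x $ (2 * j - 2) + x $ (2 * j - 1)))"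
    unfolding all using row bj by simp
  have nonneg: "\<forall>j<2 * r. x $ j \<ge> 0" if ?L
  proof (intro allI impI)
    fix j assume "j < 2 * r"
    then show "x $ j \<ge> 0" using lw_feasible_nonneg[OF t that, of "j + 1"] by simp
  qed
  have L: "?L \<longleftrightarrow> (\<forall>i<3 * r - 1. B $ i \<le> lw_b r t $ i) \<and> x $ (2 * r - 2) \<ge> 0 \<and> x $ (2 * r - 1) \<ge> 0"
    unfolding le by (simp add: lw_feasible_def numeral_2_eq_2)
  show ?thesis
    unfolding B_def[symmetric] ex
  proof
    assume ?L
    then show "(\<forall>i<3 * r - 1. B $ i \<le> lw_b r t $ i) \<and> (\<forall>j<2 * r. x $ j \<ge> 0)"
      using L nonneg by blast
  next
    assume R: "(\<forall>i<3 * r - 1. B $ i \<le> lw_b r t $ i) \<and> (\<forall>j<2 * r. x $ j \<ge> 0)"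
    have "2 * r - 2 < 2 * r" "2 * r - 1 < 2 * r" using r by linarith+
    then show ?L using L R by blast
  qed
qed

end

theory Submission
  imports Defs "HOL-Analysis.Function_Topology"
begin

text \<open>Put \<open>\<mu> = t powr \<theta>\<close>. The gap identity
  \<open>\<Sum> x'\<^sub>j s\<^sub>j + \<Sum> w'\<^sub>i y\<^sub>i = c \<bullet> x' - c \<bullet> x + (n + m) \<mu>\<close> shows that, up to factors depending
  on \<open>r\<close> only, every coordinate of the central point is at least that of any feasible point with
  \<open>X 1 \<le> \<mu>\<close>. So each primal coordinate has the order of a power of \<open>t\<close> whose exponent is a
  piecewise linear function of \<open>\<theta>\<close> given by a max-plus recursion. The two exponents at level \<open>i\<close>
  form a staircase with \<open>2 ^ i\<close> steps: their sum is \<open>\<theta>\<close> plus a constant and their difference is a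
  zigzag. For large \<open>t\<close>, consecutive steps are increments almost parallel to distinct coordinate
  axes, so they are nearly orthogonal.\<close>

section \<open>Angles and inscribed polygons\<close>

text \<open>Upper bounds on the central point come from feasibility alone, once a comparison with
  \<open>x' = 0\<close>, \<open>w' = b\<close> has shown that \<open>X 1\<close> has order at most
  \<mu>. Lower bounds need one feasible point at which all variables and all slacks have their
  largest possible order simultaneously; giving up a factor 2 per level provides it. The doubling
  comes from folding: min and max have the same sum as their arguments, while their difference is
  minus the absolute value of the old difference. The exponents \<open>1 - 1 / 2 ^ j\<close> of the
  program recentre the folded zigzag around 0, so each level doubles the number of pieces and halves
  the amplitude. The last pair of variables blurs level \<open>r - 2\<close> through min and max.
  The slacks of the two bounds on \<open>X (2 r - 1)\<close> show it unblurred, multiplied by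
  \<open>t\<close>, and for \<open>r \<ge> 3\<close> the larger of the two dominates all other
  coordinates at the breakpoints, dual ones included. The margin of this domination is only
  \<open>1 / 2 ^ (r - 1)\<close> in the exponent, and it has to absorb constants exponential in
  \<open>r\<close>. This is what forces \<open>t\<close> to be huge.\<close>

definition concentrated :: "real \<Rightarrow> nat set \<Rightarrow> real vec \<Rightarrow> bool" where
  "concentrated e S u \<longleftrightarrow>
     (\<exists>U>0. (\<exists>p<dim_vec u. U \<le> \<bar>u $ p\<bar>) \<and> (\<forall>i<dim_vec u. i \<notin> S \<longrightarrow> \<bar>u $ i\<bar> \<le> e * U))"

lemma abs_index_le_norm:
  fixes u :: "real vec"
  assumes "i < dim_vec u"
  shows "\<bar>u $ i\<bar> \<le> sqrt (u \<bullet> u)"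
proof -
  have "(u $ i)\<^sup>2 \<le> (\<Sum>k\<in>{0..<dim_vec u}. (u $ k)\<^sup>2)"
    using assms by (intro member_le_sum) auto
  then show ?thesis
    by (intro real_le_rsqrt) (simp add: scalar_prod_def power2_eq_square)
qed

text \<open>The scale \<open>U\<close> in the definition is left free, so that a single large
  coordinate has to be estimated. Passing from \<open>U\<close> to the norm is harmless because the
  norm is at least \<open>U\<close>.\<close>

lemma concentratedD:
  assumes "concentrated e S u" "e > 0"
  shows "sqrt (u \<bullet> u) > 0" "\<And>i. i < dim_vec u \<Longrightarrow> i \<notin> S \<Longrightarrow> \<bar>u $ i\<bar> \<le> e * sqrt (u \<bullet> u)"
proof -
  obtain U p where U: "U > 0" "p < dim_vec u" "U \<le> \<bar>u $ p\<bar>"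
      "\<And>i. i < dim_vec u \<Longrightarrow> i \<notin> S \<Longrightarrow> \<bar>u $ i\<bar> \<le> e * U"
    using assms(1) unfolding concentrated_def by blast
  have le: "U \<le> sqrt (u \<bullet> u)" using U(3) abs_index_le_norm[OF U(2)] by linarith
  then show "sqrt (u \<bullet> u) > 0" using U(1) by linarith
  show "\<bar>u $ i\<bar> \<le> e * sqrt (u \<bullet> u)" if "i < dim_vec u" "i \<notin> S" for i
  proof -
    have "e * U \<le> e * sqrt (u \<bullet> u)" using le assms(2) by simp
    then show ?thesis using U(4)[OF that] by linarith
  qed
qed

text \<open>In each coordinate at least one of the two vectors is small relative to its norm, so the
  cosine is at most \<open>d * e \<le> 1 / 2\<close> in absolute value. One radian is a convenient
  bound since \<open>cos 1 \<ge> 1 / 2\<close>.\<close>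

lemma vec_angle_concentrated:
  assumes u: "concentrated e S u" "dim_vec u = d" and v: "concentrated e T v" "dim_vec v = d"
    and disj: "S \<inter> T = {}" and e: "e > 0" "real d * e \<le> 1 / 2"
  shows "vec_angle u v \<ge> 1"
proof -
  define nu nv where "nu = sqrt (u \<bullet> u)" and "nv = sqrt (v \<bullet> v)"
  note nn = nu_def nv_def
  have pos: "nu > 0" "nv > 0" using concentratedD(1) u(1) v(1) e(1) unfolding nn by blast+
  have summand: "\<bar>u $ i * v $ i\<bar> \<le> e * (nu * nv)" if i: "i < d" for i
  proof (cases "i \<in> S")
    case True
    then have "\<bar>v $ i\<bar> \<le> e * nv" "\<bar>u $ i\<bar> \<le> nu"
      using concentratedD(2)[OF v(1) e(1)] abs_index_le_norm i u(2) v(2) disj unfolding nn by auto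
    then have "\<bar>u $ i\<bar> * \<bar>v $ i\<bar> \<le> nu * (e * nv)" using pos by (intro mult_mono) auto
    then show ?thesis by (simp add: abs_mult mult_ac)
  next
    case False
    then have "\<bar>u $ i\<bar> \<le> e * nu" "\<bar>v $ i\<bar> \<le> nv"
      using concentratedD(2)[OF u(1) e(1)] abs_index_le_norm i u(2) v(2) unfolding nn by auto
    then have "\<bar>u $ i\<bar> * \<bar>v $ i\<bar> \<le> (e * nu) * nv" using pos e by (intro mult_mono) auto
    then show ?thesis by (simp add: abs_mult mult_ac)
  qed
  have "\<bar>u \<bullet> v\<bar> \<le> (\<Sum>i\<in>{0..<d}. \<bar>u $ i * v $ i\<bar>)"
    unfolding scalar_prod_def v(2) by (rule sum_abs)
  also have "\<dots> \<le> (\<Sum>i\<in>{0..<d}. e * (nu * nv))" using summand by (intro sum_mono) auto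
  also have "\<dots> = (real d * e) * (nu * nv)" by simp
  also have "\<dots> \<le> 1 / 2 * (nu * nv)" using e(2) pos by (intro mult_right_mono) auto
  finally have "\<bar>(u \<bullet> v) / (nu * nv)\<bar> \<le> 1 / 2"
    using pos by (simp add: abs_mult divide_le_eq)
  moreover have "cos 1 \<ge> (1 / 2 :: real)"
  proof -
    have "(sin (1 / 2))\<^sup>2 \<le> (1 / 2 :: real)\<^sup>2"
      using sin_x_le_x[of "1 / 2"] sin_ge_zero[of "1 / 2"] pi_ge_two by (intro power_mono) auto
    then show ?thesis using cos_double_sin[of "1 / 2 :: real"] by (simp add: power2_eq_square)
  qed
  ultimately have "arccos (cos 1) \<le> arccos ((u \<bullet> v) / (nu * nv))"
    by (intro arccos_le_arccos) (linarith, linarith, simp)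
  then show ?thesis using pi_ge_two arccos_cos[of 1] unfolding vec_angle_def nn by simp
qed

text \<open>Off \<open>S\<close> both endpoints lie between 0 and \<open>L\<close>, hence so does
  the absolute value of their difference, while coordinate \<open>p\<close> moves by at least
  \<open>H - L\<close>. The factor \<open>1 + 2 d\<close> is what turns this into
  \<open>L \<le> (H - L) / (2 d)\<close>.\<close>

lemma concentrated_diff:
  assumes z: "dim_vec z = d" "dim_vec z' = d" and p: "p < d" "z $ p \<le> L" "H \<le> z' $ p"
    and off: "\<And>i. i < d \<Longrightarrow> i \<notin> S \<Longrightarrow> 0 \<le> z $ i \<and> z $ i \<le> L \<and> 0 \<le> z' $ i \<and> z' $ i \<le> L"
    and L: "L > 0" "(1 + 2 * real d) * L \<le> H"
  shows "concentrated (1 / (2 * real d)) S (z' - z)"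
  unfolding concentrated_def
proof (intro exI[of _ "H - L"] conjI allI impI)
  have d: "real d > 0" using p(1) by simp
  have HL: "2 * real d * L \<le> H - L" using L(2) by (simp add: algebra_simps)
  moreover have "2 * real d * L > 0" using d L(1) by simp
  ultimately show "H - L > 0" by linarith
  show "\<exists>p<dim_vec (z' - z). H - L \<le> \<bar>(z' - z) $ p\<bar>"
    using p z by (intro exI[of _ p]) auto
  fix i assume "i < dim_vec (z' - z)" "i \<notin> S"
  then have "\<bar>(z' - z) $ i\<bar> \<le> L" using off[of i] z by auto
  also have "L \<le> 1 / (2 * real d) * (H - L)" using HL d by (simp add: field_simps)
  finally show "\<bar>(z' - z) $ i\<bar> \<le> 1 / (2 * real d) * (H - L)" .
qed

text \<open>A polygon with \<open>K\<close> segments has \<open>K - 1\<close> angles, each at least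
  1 because the accuracy \<open>1 / (2 d)\<close> makes \<open>d * e\<close> equal to 1/2.
  Concentration also rules out zero segments, as inscribed polygons require.\<close>

lemma total_curvature_ge:
  assumes T: "\<And>k. k \<le> K \<Longrightarrow> T k \<in> I" "\<And>k. k < K \<Longrightarrow> T k < T (Suc k)"
    and dim: "\<And>k. k \<le> K \<Longrightarrow> dim_vec (\<gamma> (T k)) = d"
    and conc: "\<And>k. k < K \<Longrightarrow> concentrated (1 / (2 * real d)) (S k) (\<gamma> (T (Suc k)) - \<gamma> (T k))"
    and disj: "\<And>k. Suc k < K \<Longrightarrow> S k \<inter> S (Suc k) = {}"
  shows "ereal (real (K - 1)) \<le> total_curvature I \<gamma>"
proof -
  define \<tau> where "\<tau> = map T [0..<Suc K]"
  have len: "length \<tau> = Suc K" and nth: "\<And>k. k \<le> K \<Longrightarrow> \<tau> ! k = T k"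
    unfolding \<tau>_def by (auto simp del: upt_Suc)
  have mono: "T i < T j" if "i < j" "j \<le> K" for i j
    using that
  proof (induction j)
    case (Suc j)
    then show ?case using T(2)[of j] by (cases "i = j") auto
  qed simp
  have "sorted_wrt (<) \<tau>"
    unfolding sorted_wrt_iff_nth_less len using mono by (auto simp: nth)
  moreover have "set \<tau> \<subseteq> I" using T(1) unfolding \<tau>_def by auto
  moreover have "\<gamma> (\<tau> ! i) \<noteq> \<gamma> (\<tau> ! (i + 1))" if "i + 1 < length \<tau>" for i
  proof
    assume eq: "\<gamma> (\<tau> ! i) = \<gamma> (\<tau> ! (i + 1))"
    have i: "i < K" using that len by simp
    have "\<gamma> (T (Suc i)) - \<gamma> (T i) = 0\<^sub>v d" using eq i dim[of i] dim[of "Suc i"] nth by auto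
    then have "concentrated (1 / (2 * real d)) (S i) (0\<^sub>v d)" using conc[OF i] by simp
    then show False unfolding concentrated_def by auto
  qed
  ultimately have mem: "map \<gamma> \<tau> \<in> inscribed_polygons I \<gamma>"
    unfolding inscribed_polygons_def by blast
  have "real (K - 1) = (\<Sum>i<length (map \<gamma> \<tau>) - 2. 1)" using len by simp
  also have "\<dots> \<le> polygon_curvature (map \<gamma> \<tau>)"
    unfolding polygon_curvature_def
  proof (rule sum_mono)
    fix i assume "i \<in> {..<length (map \<gamma> \<tau>) - 2}"
    then have i: "Suc i < K" using len by simp
    have d: "0 < d" using conc[of i] dim[of i] i unfolding concentrated_def
      using dim[of "Suc i"] by (cases d) auto
    have "1 \<le> vec_angle (\<gamma> (T (Suc i)) - \<gamma> (T i)) (\<gamma> (T (Suc (Suc i))) - \<gamma> (T (Suc i)))"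
      by (rule vec_angle_concentrated[OF conc _ conc _ disj])
        (use i d dim in \<open>auto simp: field_simps\<close>)
    then show "1 \<le> vec_angle (map \<gamma> \<tau> ! (i + 1) - map \<gamma> \<tau> ! i)
        (map \<gamma> \<tau> ! (i + 2) - map \<gamma> \<tau> ! (i + 1))"
      using i len nth by simp
  qed
  finally have "ereal (real (K - 1)) \<le> ereal (polygon_curvature (map \<gamma> \<tau>))" by simp
  also have "\<dots> \<le> total_curvature I \<gamma>"
    unfolding total_curvature_def by (rule SUP_upper[OF mem])
  finally show ?thesis .
qed

section \<open>The central path of a general linear program\<close>

text \<open>By the dual equation the left side equals \<open>c \<bullet> x' + b \<bullet> y\<close>
  for every solution of the primal equations. At \<open>x\<close>, \<open>w\<close> itself
  complementarity evaluates it to \<open>(n + m) \<mu>\<close>, which eliminates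
  \<open>b \<bullet> y\<close>.\<close>

lemma central_path_gap:
  assumes sys: "central_path_system A b c \<mu> x w s y" and A: "A \<in> carrier_mat m n"
    and c: "c \<in> carrier_vec n"
    and x': "x' \<in> carrier_vec n" and w': "w' \<in> carrier_vec m" and feas: "A *\<^sub>v x' + w' = b"
  shows "(\<Sum>j<n. x' $ j * s $ j) + (\<Sum>i<m. w' $ i * y $ i) = c \<bullet> x' - c \<bullet> x + real (n + m) * \<mu>"
proof -
  have x: "x \<in> carrier_vec n" "w \<in> carrier_vec m" "s \<in> carrier_vec n" "y \<in> carrier_vec m"
    and Ax: "A *\<^sub>v x + w = b" and dual: "s - transpose_mat A *\<^sub>v y = c"
    and comp: "\<And>j. j < n \<Longrightarrow> x $ j * s $ j = \<mu>" "\<And>i. i < m \<Longrightarrow> w $ i * y $ i = \<mu>"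
    using sys A unfolding central_path_system_def by auto
  have b: "b \<in> carrier_vec m" using Ax x A by auto
  have gap: "(\<Sum>j<n. z $ j * s $ j) + (\<Sum>i<m. v $ i * y $ i) = c \<bullet> z + b \<bullet> y"
    if z: "z \<in> carrier_vec n" "v \<in> carrier_vec m" "A *\<^sub>v z + v = b" for z v
  proof -
    have s: "s = c + transpose_mat A *\<^sub>v y" using dual x A c by (intro eq_vecI) auto
    have "(\<Sum>j<n. z $ j * s $ j) = s \<bullet> z"
      using z by (auto simp: scalar_prod_def atLeast0LessThan mult.commute intro!: sum.cong)
    also have "\<dots> = c \<bullet> z + (transpose_mat A *\<^sub>v y) \<bullet> z"
      unfolding s by (rule add_scalar_prod_distrib[of _ n]) (use z c x A in auto)
    also have "(transpose_mat A *\<^sub>v y) \<bullet> z = y \<bullet> (A *\<^sub>v z)"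
      by (rule transpose_vec_mult_scalar[OF A z(1) x(4)])
    finally have 1: "(\<Sum>j<n. z $ j * s $ j) = c \<bullet> z + y \<bullet> (A *\<^sub>v z)" .
    have 2: "(\<Sum>i<m. v $ i * y $ i) = y \<bullet> v"
      using z by (auto simp: scalar_prod_def atLeast0LessThan mult.commute intro!: sum.cong)
    have "y \<bullet> (A *\<^sub>v z) + y \<bullet> v = y \<bullet> b"
      unfolding z(3)[symmetric] by (rule scalar_prod_add_distrib[of _ m, symmetric]) (use z x A in auto)
    moreover have "y \<bullet> b = b \<bullet> y" by (rule comm_scalar_prod[of _ m]) (use b x in auto)
    ultimately show ?thesis using 1 2 by linarith
  qed
  have "(\<Sum>j<n. x $ j * s $ j) + (\<Sum>i<m. w $ i * y $ i) = real (n + m) * \<mu>"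
    using sum.cong[of "{..<n}" "{..<n}" "\<lambda>j. x $ j * s $ j" "\<lambda>j. \<mu>"]
      sum.cong[of "{..<m}" "{..<m}" "\<lambda>i. w $ i * y $ i" "\<lambda>i. \<mu>"] comp
    by (simp add: algebra_simps)
  then have "c \<bullet> x + b \<bullet> y = real (n + m) * \<mu>" using gap[OF x(1,2) Ax] by linarith
  then show ?thesis using gap[OF x' w' feas] by linarith
qed

section \<open>Uniqueness of the central point\<close>

lemma div_add_div_ge_2:
  fixes a b :: real
  assumes "a > 0" "b > 0"
  shows "a / b + b / a \<ge> 2" "a / b + b / a = 2 \<Longrightarrow> a = b"
proof -
  have eq: "a / b + b / a - 2 = (a - b)\<^sup>2 / (a * b)"
    using assms by (simp add: field_simps power2_eq_square)
  then show "a / b + b / a \<ge> 2" using assms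
    by (smt (verit) divide_nonneg_pos mult_pos_pos zero_le_power2)
  show "a = b" if "a / b + b / a = 2"
    using eq that assms by auto
qed

text \<open>Adding the gap identities of two solutions gives \<open>\<Sum> (z/z' + z'/z) = 2 (n + m)\<close>, in which
  every summand is at least 2.\<close>

lemma central_path_system_unique:
  assumes sys: "central_path_system A b c \<mu> x w s y" and sys': "central_path_system A b c \<mu> x' w' s' y'"
    and A: "A \<in> carrier_mat m n" and c: "c \<in> carrier_vec n" and \<mu>: "\<mu> > 0"
  shows "x = x' \<and> w = w' \<and> s = s' \<and> y = y'"
proof -
  have x: "x \<in> carrier_vec n" "w \<in> carrier_vec m" "s \<in> carrier_vec n" "y \<in> carrier_vec m"
    and Ax: "A *\<^sub>v x + w = b"
    and xs: "\<And>j. j < n \<Longrightarrow> x $ j * s $ j = \<mu>" "\<And>i. i < m \<Longrightarrow> w $ i * y $ i = \<mu>"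
    and xpos: "\<And>j. j < n \<Longrightarrow> x $ j > 0" "\<And>i. i < m \<Longrightarrow> w $ i > 0"
    using sys A unfolding central_path_system_def by auto
  have x': "x' \<in> carrier_vec n" "w' \<in> carrier_vec m" "s' \<in> carrier_vec n" "y' \<in> carrier_vec m"
    and Ax': "A *\<^sub>v x' + w' = b"
    and xs': "\<And>j. j < n \<Longrightarrow> x' $ j * s' $ j = \<mu>" "\<And>i. i < m \<Longrightarrow> w' $ i * y' $ i = \<mu>"
    and xpos': "\<And>j. j < n \<Longrightarrow> x' $ j > 0" "\<And>i. i < m \<Longrightarrow> w' $ i > 0"
    using sys' A unfolding central_path_system_def by auto
  have sj: "s $ j = \<mu> / x $ j" "s' $ j = \<mu> / x' $ j" if "j < n" for j
    using xs(1) xs'(1) xpos(1) xpos'(1) that by (simp_all add: field_simps less_imp_neq[THEN not_sym])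
  have yi: "y $ i = \<mu> / w $ i" "y' $ i = \<mu> / w' $ i" if "i < m" for i
    using xs(2) xs'(2) xpos(2) xpos'(2) that by (simp_all add: field_simps less_imp_neq[THEN not_sym])
  let ?P = "\<lambda>j. x' $ j / x $ j + x $ j / x' $ j" and ?Q = "\<lambda>i. w' $ i / w $ i + w $ i / w' $ i"
  have "(\<Sum>j<n. x' $ j * s $ j) + (\<Sum>i<m. w' $ i * y $ i) +
      ((\<Sum>j<n. x $ j * s' $ j) + (\<Sum>i<m. w $ i * y' $ i)) = 2 * real (n + m) * \<mu>"
    using central_path_gap[OF sys A c x'(1,2) Ax'] central_path_gap[OF sys' A c x(1,2) Ax] by simp
  \<comment> \<open>Complementarity replaces each dual coordinate by \<mu> over the primal one, so
    the mixed products become ratios.\<close>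
  also have "(\<Sum>j<n. x' $ j * s $ j) + (\<Sum>i<m. w' $ i * y $ i) +
      ((\<Sum>j<n. x $ j * s' $ j) + (\<Sum>i<m. w $ i * y' $ i)) =
      \<mu> * ((\<Sum>j<n. ?P j) + (\<Sum>i<m. ?Q i))"
    by (simp add: sj yi sum.distrib sum_distrib_left algebra_simps)
  finally have tot: "(\<Sum>j<n. ?P j) + (\<Sum>i<m. ?Q i) = 2 * real (n + m)" using \<mu> by simp
  have P: "?P j \<ge> 2" if "j < n" for j using div_add_div_ge_2(1) xpos(1) xpos'(1) that by blast
  have Q: "?Q j \<ge> 2" if "j < m" for j using div_add_div_ge_2(1) xpos(2) xpos'(2) that by blast
  have "(\<Sum>j<n. ?P j - 2) + (\<Sum>i<m. ?Q i - 2) = 0"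
    unfolding sum_subtractf using tot by simp
  moreover have "(\<Sum>j<n. ?P j - 2) \<ge> 0" "(\<Sum>i<m. ?Q i - 2) \<ge> 0"
    using P Q by (auto intro!: sum_nonneg simp del: sum_subtractf)
  ultimately have "(\<Sum>j<n. ?P j - 2) = 0" "(\<Sum>i<m. ?Q i - 2) = 0" by linarith+
  then have zero: "\<forall>j\<in>{..<n}. ?P j - 2 = 0" "\<forall>i\<in>{..<m}. ?Q i - 2 = 0"
    by (subst (asm) sum_nonneg_eq_0_iff; use P Q in force)+
  have X: "x' $ j = x $ j" if "j < n" for j
    using zero(1) div_add_div_ge_2(2) xpos(1) xpos'(1) that by auto
  have W: "w' $ j = w $ j" if "j < m" for j
    using zero(2) div_add_div_ge_2(2) xpos(2) xpos'(2) that by auto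
  show ?thesis
    using x x' X W sj yi by (auto intro!: eq_vecI)
qed

section \<open>Existence of the central point by the logarithmic barrier\<close>

text \<open>A maximiser of the exponential of minus the barrier function over the closed polytope is an
  interior point, since the product vanishes on the boundary.\<close>

lemma barrier_maximiser:
  fixes a :: "nat \<Rightarrow> nat \<Rightarrow> real" and b c :: "nat \<Rightarrow> real"
  assumes x0: "\<And>j. j < n \<Longrightarrow> x0 j > 0" "\<And>i. i < m \<Longrightarrow> b i - (\<Sum>k<n. a i k * x0 k) > 0"
    and bounded: "\<And>x j. (\<And>j. j < n \<Longrightarrow> x j \<ge> 0) \<Longrightarrow>
      (\<And>i. i < m \<Longrightarrow> (\<Sum>k<n. a i k * x k) \<le> b i) \<Longrightarrow> j < n \<Longrightarrow> x j \<le> B"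
  obtains x where "\<And>j. j < n \<Longrightarrow> x j > 0" "\<And>i. i < m \<Longrightarrow> b i - (\<Sum>k<n. a i k * x k) > 0"
    "\<And>x'. (\<And>j. j < n \<Longrightarrow> x' j > 0) \<Longrightarrow> (\<And>i. i < m \<Longrightarrow> b i - (\<Sum>k<n. a i k * x' k) > 0) \<Longrightarrow>
      - (\<Sum>k<n. c k * x' k) + (\<Sum>j<n. ln (x' j)) + (\<Sum>i<m. ln (b i - (\<Sum>k<n. a i k * x' k))) \<le>
      - (\<Sum>k<n. c k * x k) + (\<Sum>j<n. ln (x j)) + (\<Sum>i<m. ln (b i - (\<Sum>k<n. a i k * x k)))"
proof -
  define w where "w = (\<lambda>x i. b i - (\<Sum>k<n. a i k * x k))"
  define g where "g = (\<lambda>x. exp (- (\<Sum>k<n. c k * x k)) * (\<Prod>j<n. x j) * (\<Prod>i<m. w x i))"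
  \<comment> \<open>Points of dimension \<open>n\<close> are represented by functions on all of
    \<open>nat\<close>. Freezing the coordinates from \<open>n\<close> on at 0 makes the box a
    product of compact sets, hence compact.\<close>
  define F where "F = PiE UNIV (\<lambda>j. if j < n then {0..B} else {0::real})"
  define P where "P = F \<inter> {x. \<forall>i<m. w x i \<ge> 0}"
  have coord: "continuous_on S (\<lambda>x. x j :: real)" for S :: "(nat \<Rightarrow> real) set" and j
    by (rule continuous_on_subset[OF continuous_on_product_coordinates]) simp
  have "compactin (product_topology (\<lambda>i. euclidean) UNIV) F"
    unfolding F_def compactin_PiE by simp
  then have cF: "compact F" by (simp add: euclidean_product_topology)
  have contw: "continuous_on S (\<lambda>x. w x i)" for S i
    unfolding w_def by (intro continuous_intros coord)
  have "closed {x. \<forall>i<m. w x i \<ge> 0}"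
    by (intro closed_Collect_all closed_Collect_imp closed_Collect_le contw continuous_intros) auto
  then have cP: "compact P" unfolding P_def using cF by (rule compact_Int_closed[rotated])
  have contg: "continuous_on P g"
    unfolding g_def by (intro continuous_intros coord contw)
  have mem: "(\<lambda>j. if j < n then x j else 0) \<in> P"
    if "\<And>j. j < n \<Longrightarrow> x j > 0" "\<And>i. i < m \<Longrightarrow> w x i > 0" for x
  proof -
    have "x j \<le> B" if "j < n" for j
      using bounded[of x j] \<open>\<And>j. j < n \<Longrightarrow> x j > 0\<close> \<open>\<And>i. i < m \<Longrightarrow> w x i > 0\<close> that
      by (auto simp: w_def less_imp_le)
    then show ?thesis using that by (auto simp: P_def F_def w_def less_imp_le)
  qed
  have trunc: "g (\<lambda>j. if j < n then x j else 0) = g x" for x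
    by (simp add: g_def w_def)
  have gpos: "g x > 0" if "\<And>j. j < n \<Longrightarrow> x j > 0" "\<And>i. i < m \<Longrightarrow> w x i > 0" for x
    using that unfolding g_def by (auto intro!: mult_pos_pos prod_pos)
  have "P \<noteq> {}" using mem[of x0] x0 unfolding w_def by blast
  then obtain x where x: "x \<in> P" "\<And>x'. x' \<in> P \<Longrightarrow> g x' \<le> g x"
    using continuous_attains_sup[OF cP _ contg] by blast
  have max: "g x' \<le> g x" if "\<And>j. j < n \<Longrightarrow> x' j > 0" "\<And>i. i < m \<Longrightarrow> w x' i > 0" for x'
    using x(2)[OF mem[of x']] that trunc by simp
  have gx: "g x > 0" using gpos[of x0] max[of x0] x0 unfolding w_def by force
  have nn: "x j \<ge> 0" if "j < n" for j
    using x(1) that by (auto simp: P_def F_def PiE_iff split: if_splits dest: spec[of _ j])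
  have wn: "w x i \<ge> 0" if "i < m" for i using x(1) that by (auto simp: P_def)
  have prods: "(\<Prod>j<n. x j) \<noteq> 0" "(\<Prod>i<m. w x i) \<noteq> 0" using gx unfolding g_def by (metis less_irrefl mult_zero_left mult_zero_right)+
  have pos: "x j > 0" if "j < n" for j
    using nn[OF that] prods(1) that by (auto simp: order_less_le)
  have wpos: "w x i > 0" if "i < m" for i
    using wn[OF that] prods(2) that by (auto simp: order_less_le)
  have lng: "ln (g x) = - (\<Sum>k<n. c k * x k) + (\<Sum>j<n. ln (x j)) + (\<Sum>i<m. ln (w x i))"
    if "\<And>j. j < n \<Longrightarrow> x j > 0" "\<And>i. i < m \<Longrightarrow> w x i > 0" for x
  proof -
    have "(\<Prod>j<n. x j) > 0" "(\<Prod>i<m. w x i) > 0" using that by (auto intro!: prod_pos)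
    moreover have "ln (\<Prod>j<n. x j) = (\<Sum>j<n. ln (x j))" "ln (\<Prod>i<m. w x i) = (\<Sum>i<m. ln (w x i))"
      using that by (force intro: ln_prod)+
    ultimately show ?thesis unfolding g_def by (simp add: ln_mult_pos)
  qed
  show ?thesis
  proof (rule that[OF pos])
    show "b i - (\<Sum>k<n. a i k * x k) > 0" if "i < m" for i using wpos[OF that] by (simp add: w_def)
    fix x' assume *: "\<And>j. j < n \<Longrightarrow> x' j > 0" "\<And>i. i < m \<Longrightarrow> b i - (\<Sum>k<n. a i k * x' k) > 0"
    then have x': "\<And>j. j < n \<Longrightarrow> x' j > 0" "\<And>i. i < m \<Longrightarrow> w x' i > 0" by (auto simp: w_def)
    have "ln (g x') \<le> ln (g x)" using max[OF x'] gpos[OF x'] gx by simp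
    then show "- (\<Sum>k<n. c k * x' k) + (\<Sum>j<n. ln (x' j)) + (\<Sum>i<m. ln (b i - (\<Sum>k<n. a i k * x' k))) \<le>
      - (\<Sum>k<n. c k * x k) + (\<Sum>j<n. ln (x j)) + (\<Sum>i<m. ln (b i - (\<Sum>k<n. a i k * x k)))"
      using lng[OF x'] lng[OF pos wpos] unfolding w_def by simp
  qed
qed

text \<open>First-order condition at the maximiser, one coordinate direction at a time. Along such a
  line all variables and slacks stay positive near 0, which suffices for a local maximum.\<close>

lemma barrier_stationary_point:
  fixes a :: "nat \<Rightarrow> nat \<Rightarrow> real" and b c :: "nat \<Rightarrow> real"
  assumes x0: "\<And>j. j < n \<Longrightarrow> x0 j > 0" "\<And>i. i < m \<Longrightarrow> b i - (\<Sum>k<n. a i k * x0 k) > 0"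
    and bounded: "\<And>x j. (\<And>j. j < n \<Longrightarrow> x j \<ge> 0) \<Longrightarrow>
      (\<And>i. i < m \<Longrightarrow> (\<Sum>k<n. a i k * x k) \<le> b i) \<Longrightarrow> j < n \<Longrightarrow> x j \<le> B"
  obtains x where "\<And>j. j < n \<Longrightarrow> x j > 0" "\<And>i. i < m \<Longrightarrow> b i - (\<Sum>k<n. a i k * x k) > 0"
    "\<And>j. j < n \<Longrightarrow> 1 / x j - (\<Sum>i<m. a i j / (b i - (\<Sum>k<n. a i k * x k))) = c j"
proof -
  obtain x where x: "\<And>j. j < n \<Longrightarrow> x j > 0" "\<And>i. i < m \<Longrightarrow> b i - (\<Sum>k<n. a i k * x k) > 0"
    and max: "\<And>x'. (\<And>j. j < n \<Longrightarrow> x' j > 0) \<Longrightarrow> (\<And>i. i < m \<Longrightarrow> b i - (\<Sum>k<n. a i k * x' k) > 0) \<Longrightarrow>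
      - (\<Sum>k<n. c k * x' k) + (\<Sum>j<n. ln (x' j)) + (\<Sum>i<m. ln (b i - (\<Sum>k<n. a i k * x' k))) \<le>
      - (\<Sum>k<n. c k * x k) + (\<Sum>j<n. ln (x j)) + (\<Sum>i<m. ln (b i - (\<Sum>k<n. a i k * x k)))"
    by (rule barrier_maximiser[of n x0 m b a B c]; (rule x0 bounded)?; blast)
  show ?thesis
  proof (rule that[OF x])
    fix j assume j: "j < n"
    define w where "w = (\<lambda>i. b i - (\<Sum>k<n. a i k * x k))"
    define e where "e = (\<lambda>k. if k = j then 1 else 0 :: real)"
    have sum_e: "(\<Sum>k<n. f k * (x k + e k * \<theta>)) = (\<Sum>k<n. f k * x k) + f j * \<theta>" for f \<theta>
    proof -
      have "(\<Sum>k<n. f k * (x k + e k * \<theta>)) = (\<Sum>k<n. f k * x k) + (\<Sum>k<n. if k = j then f j * \<theta> else 0)"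
        unfolding sum.distrib[symmetric] by (intro sum.cong) (auto simp: e_def algebra_simps)
      then show ?thesis using j by simp
    qed
    define h where "h = (\<lambda>\<theta>. - ((\<Sum>k<n. c k * x k) + c j * \<theta>) + (\<Sum>k<n. ln (x k + e k * \<theta>)) +
      (\<Sum>i<m. ln (w i - a i j * \<theta>)))"
    have wpos: "w i > 0" if "i < m" for i using x(2)[OF that] by (simp add: w_def)
    have "((\<lambda>\<theta>. x k + e k * \<theta>) \<longlongrightarrow> x k + e k * 0) (nhds 0)" for k
      by (intro tendsto_intros filterlim_ident)
    then have ev1: "\<forall>\<^sub>F \<theta> in nhds 0. \<forall>k\<in>{..<n}. x k + e k * \<theta> > 0"
      using x(1) by (intro eventually_ball_finite ballI order_tendstoD(1)[where y="x _ + e _ * 0"]) auto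
    have "((\<lambda>\<theta>. w k - a k j * \<theta>) \<longlongrightarrow> w k - a k j * 0) (nhds 0)" for k
      by (intro tendsto_intros filterlim_ident)
    then have ev2: "\<forall>\<^sub>F \<theta> in nhds 0. \<forall>i\<in>{..<m}. w i - a i j * \<theta> > 0"
      using wpos by (intro eventually_ball_finite ballI order_tendstoD(1)[where y="w _ - a _ _ * 0"]) auto
    from eventually_conj[OF ev1 ev2]
    obtain d where d: "d > 0" "\<And>\<theta>. dist \<theta> 0 < d \<Longrightarrow>
        (\<forall>k\<in>{..<n}. x k + e k * \<theta> > 0) \<and> (\<forall>i\<in>{..<m}. w i - a i j * \<theta> > 0)"
      unfolding eventually_nhds_metric by blast
    have "(h has_real_derivative - c j + (\<Sum>k<n. e k / x k) + (\<Sum>i<m. - a i j / w i)) (at 0)"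
      unfolding h_def
      by (rule derivative_eq_intros refl | (use x(1) wpos in force))+
    moreover have "\<forall>\<theta>. \<bar>0 - \<theta>\<bar> < d \<longrightarrow> h \<theta> \<le> h 0"
    proof (intro allI impI)
      fix \<theta> assume "\<bar>0 - \<theta>\<bar> < d"
      then have \<theta>: "\<forall>k\<in>{..<n}. x k + e k * \<theta> > 0" "\<forall>i\<in>{..<m}. w i - a i j * \<theta> > 0"
        using d(2)[of \<theta>] by (auto simp: dist_real_def)
      show "h \<theta> \<le> h 0"
        using max[of "\<lambda>k. x k + e k * \<theta>"] \<theta> unfolding sum_e
        by (simp add: h_def w_def algebra_simps)
    qed
    ultimately have "- c j + (\<Sum>k<n. e k / x k) + (\<Sum>i<m. - a i j / w i) = 0"
      using DERIV_local_max[OF _ d(1)] by blast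
    moreover have "(\<Sum>k<n. e k / x k) = 1 / x j"
    proof -
      have "(\<Sum>k<n. e k / x k) = (\<Sum>k<n. if k = j then 1 / x j else 0)"
        by (intro sum.cong) (auto simp: e_def)
      then show ?thesis using j by simp
    qed
    ultimately show "1 / x j - (\<Sum>i<m. a i j / (b i - (\<Sum>k<n. a i k * x k))) = c j"
      unfolding w_def by (simp add: sum_negf)
  qed
qed

text \<open>The barrier is taken with objective \<open>c / \<mu>\<close>. Its stationarity equation
  multiplied by \<mu> is the dual equation for \<open>s = \<mu> / x\<close> and
  \<open>y = \<mu> / w\<close>, and with this choice complementarity is immediate.\<close>

lemma central_path_system_exists:
  assumes A: "A \<in> carrier_mat m n" and b: "b \<in> carrier_vec m" and c: "c \<in> carrier_vec n"
    and \<mu>: "\<mu> > 0"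
    and x0: "x0 \<in> carrier_vec n" "\<And>j. j < n \<Longrightarrow> x0 $ j > 0" "\<And>i. i < m \<Longrightarrow> (A *\<^sub>v x0) $ i < b $ i"
    and bounded: "\<And>x j. x \<in> carrier_vec n \<Longrightarrow> (\<And>j. j < n \<Longrightarrow> x $ j \<ge> 0) \<Longrightarrow>
      (\<And>i. i < m \<Longrightarrow> (A *\<^sub>v x) $ i \<le> b $ i) \<Longrightarrow> j < n \<Longrightarrow> x $ j \<le> B"
  shows "\<exists>x w s y. central_path_system A b c \<mu> x w s y"
proof -
  have Av: "(A *\<^sub>v vec n f) $ i = (\<Sum>k<n. A $$ (i, k) * f k)" if "i < m" for i f
    using A that by (auto simp: scalar_prod_def atLeast0LessThan intro!: sum.cong)
  have x0v: "vec n (\<lambda>j. x0 $ j) = x0" using x0(1) by auto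
  obtain f where f: "\<And>j. j < n \<Longrightarrow> f j > 0"
      "\<And>i. i < m \<Longrightarrow> b $ i - (\<Sum>k<n. A $$ (i, k) * f k) > 0"
      "\<And>j. j < n \<Longrightarrow> 1 / f j - (\<Sum>i<m. A $$ (i, j) / (b $ i - (\<Sum>k<n. A $$ (i, k) * f k))) = c $ j / \<mu>"
  proof (rule barrier_stationary_point[of n "\<lambda>j. x0 $ j" m "\<lambda>i. b $ i" "\<lambda>i k. A $$ (i, k)" B "\<lambda>j. c $ j / \<mu>"])
    show "b $ i - (\<Sum>k<n. A $$ (i, k) * x0 $ k) > 0" if "i < m" for i
      using x0(3)[OF that] Av[OF that, of "\<lambda>j. x0 $ j"] unfolding x0v by simp
    show "g j \<le> B" if "\<And>j. j < n \<Longrightarrow> g j \<ge> 0"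
      "\<And>i. i < m \<Longrightarrow> (\<Sum>k<n. A $$ (i, k) * g k) \<le> b $ i" "j < n" for g j
      using bounded[of "vec n g" j] that Av[of _ g] by simp
  qed (use x0(2) in auto)
  define x where "x = vec n f"
  define w where "w = vec m (\<lambda>i. b $ i - (A *\<^sub>v x) $ i)"
  define s where "s = vec n (\<lambda>j. \<mu> / x $ j)"
  define y where "y = vec m (\<lambda>i. \<mu> / w $ i)"
  have w: "w $ i = b $ i - (\<Sum>k<n. A $$ (i, k) * f k)" if "i < m" for i
    using Av[OF that] that by (simp add: w_def x_def)
  have dual: "(s - transpose_mat A *\<^sub>v y) $ j = c $ j" if j: "j < n" for j
  proof -
    have "(transpose_mat A *\<^sub>v y) $ j = (\<Sum>i<m. A $$ (i, j) * (\<mu> / w $ i))"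
      using A j by (auto simp: scalar_prod_def atLeast0LessThan y_def intro!: sum.cong)
    also have "\<dots> = \<mu> * (\<Sum>i<m. A $$ (i, j) / w $ i)"
      unfolding sum_distrib_left by (intro sum.cong) auto
    also have "(\<Sum>i<m. A $$ (i, j) / w $ i) = 1 / f j - c $ j / \<mu>"
      using f(3)[OF j] w by simp
    finally show ?thesis using A j \<mu> by (simp add: s_def x_def right_diff_distrib)
  qed
  have "central_path_system A b c \<mu> x w s y"
    unfolding central_path_system_def
  proof (intro conjI)
    show "s - transpose_mat A *\<^sub>v y = c"
      by (rule eq_vecI) (use dual A c in auto)
    show "A *\<^sub>v x + w = b" by (rule eq_vecI) (use A b in \<open>auto simp: w_def x_def\<close>)
  qed (use A b \<mu> w f(1,2) f(1,2)[THEN less_imp_neq] in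
      \<open>auto simp: x_def s_def y_def\<close>, auto simp: w_def)
  then show ?thesis by blast
qed

lemma central_path_eq:
  assumes "central_path_system A b c \<mu> x w s y" and "A \<in> carrier_mat m n" and "c \<in> carrier_vec n"
    and "\<mu> > 0"
  shows "central_path A b c \<mu> = x @\<^sub>v w @\<^sub>v s @\<^sub>v y"
  unfolding central_path_def
  using central_path_system_unique[OF assms(1) _ assms(2-4)] assms(1)
  by (intro the_equality) blast+

section \<open>Exponents of the tropical central path\<close>

text \<open>On the central path with \<open>\<mu> = t powr \<theta>\<close>, \<open>0 \<le> \<theta> \<le> 2\<close>, the variables \<open>X (2 i + 1)\<close> and
  \<open>X (2 i + 2)\<close> (columns \<open>2 i\<close> and \<open>2 i + 1\<close>) have orders \<open>t powr odd_exp \<theta> i\<close> and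
  \<open>t powr even_exp \<theta> i\<close>: each variable other than \<open>X 1\<close> is as large as its upper bounds allow.\<close>

fun odd_exp :: "real \<Rightarrow> nat \<Rightarrow> real" and even_exp :: "real \<Rightarrow> nat \<Rightarrow> real" where
  "odd_exp \<theta> 0 = \<theta>"
| "odd_exp \<theta> (Suc i) = 1 + min (odd_exp \<theta> i) (even_exp \<theta> i)"
| "even_exp \<theta> 0 = 1"
| "even_exp \<theta> (Suc i) = 1 - 1 / 2 ^ Suc i + max (odd_exp \<theta> i) (even_exp \<theta> i)"

text \<open>Since \<open>min a b + max a b = a + b\<close>, each level adds to the sum a constant
  independent of \<theta>.\<close>

lemma exp_sum_diff:
  "(odd_exp \<theta>' i + even_exp \<theta>' i) - (odd_exp \<theta> i + even_exp \<theta> i) = \<theta>' - \<theta>"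
  by (induction i) auto

text \<open>The fold behind the zigzag: if the difference ranges over an interval of radius
  \<open>1 / 2 ^ i\<close> around 0, minus its absolute value ranges over the lower half, and the
  shift recentres that half around 0.\<close>

lemma exp_diff_Suc:
  "odd_exp \<theta> (Suc i) - even_exp \<theta> (Suc i) = 1 / 2 ^ Suc i - \<bar>odd_exp \<theta> i - even_exp \<theta> i\<bar>"
  by auto

lemma exp_diff_lipschitz:
  "\<bar>(odd_exp \<theta>' i - even_exp \<theta>' i) - (odd_exp \<theta> i - even_exp \<theta> i)\<bar> \<le> \<bar>\<theta>' - \<theta>\<bar>"
proof (induction i)
  case (Suc i)
  then show ?case unfolding exp_diff_Suc by linarith
qed simp

text \<open>As a function of \<open>\<theta>\<close>, the difference is a zigzag with \<open>2 ^ i\<close> pieces of slope \<open>\<plusminus>1\<close>. Passing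
  to the next level, an old breakpoint becomes a minimum, and the midpoint of a piece, where the
  difference is squeezed to 0 by the Lipschitz bound from both ends, becomes a maximum.\<close>

lemma exp_diff_breakpoint:
  "k \<le> 2 ^ i \<Longrightarrow>
    odd_exp (2 * real k / 2 ^ i) i - even_exp (2 * real k / 2 ^ i) i = (if even k then - 1 else 1) / 2 ^ i"
proof (induction i arbitrary: k)
  case 0
  then have "k = 0 \<or> k = 1" by auto
  then show ?case by auto
next
  case (Suc i)
  let ?d = "\<lambda>\<theta>. odd_exp \<theta> i - even_exp \<theta> i"
  show ?case
  proof (cases "even k")
    case True
    then obtain l where l: "k = 2 * l" by (elim evenE)
    have eq: "2 * real k / 2 ^ Suc i = 2 * real l / 2 ^ i" by (simp add: l)
    have "\<bar>?d (2 * real l / 2 ^ i)\<bar> = 1 / 2 ^ i" using Suc.IH[of l] Suc.prems l by simp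
    then show ?thesis unfolding eq exp_diff_Suc using True by (simp add: field_simps)
  next
    case False
    then obtain l where l: "k = 2 * l + 1" by (elim oddE)
    let ?x = "2 * real k / 2 ^ Suc i" and ?a = "2 * real l / 2 ^ i" and ?b = "2 * real (Suc l) / 2 ^ i"
    have dist: "?x - ?a = 1 / 2 ^ i" "?b - ?x = 1 / 2 ^ i"
      by (simp_all add: l field_simps)
    have pos: "(1::real) / 2 ^ i > 0" by simp
    have ab: "\<bar>?x - ?a\<bar> = 1 / 2 ^ i" "\<bar>?x - ?b\<bar> = 1 / 2 ^ i" using dist pos by linarith+
    have "?d ?a = (if even l then - 1 else 1) / 2 ^ i" using Suc.IH[of l] Suc.prems l by simp
    moreover have "?d ?b = (if even l then 1 else - 1) / 2 ^ i"
      using Suc.IH[of "Suc l"] Suc.prems l by simp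
    ultimately have "(?d ?a = 1 / 2 ^ i \<and> ?d ?b = - (1 / 2 ^ i)) \<or> (?d ?a = - (1 / 2 ^ i) \<and> ?d ?b = 1 / 2 ^ i)"
      by (cases "even l") auto
    moreover note exp_diff_lipschitz[of ?x i ?a, unfolded ab] exp_diff_lipschitz[of ?x i ?b, unfolded ab]
    ultimately have "?d ?x = 0" by linarith
    then show ?thesis unfolding exp_diff_Suc using False by simp
  qed
qed

text \<open>Serves the dual variables: \<mu> divided by a primal coordinate of order at least
  \<open>t powr (\<theta> - 1)\<close> has order at most \<open>t\<close>.\<close>

lemma exp_lower:
  assumes "\<theta> \<le> 2"
  shows "\<theta> - 1 \<le> odd_exp \<theta> i \<and> \<theta> - 1 \<le> even_exp \<theta> i"
proof (induction i)
  case (Suc i)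
  have "(1::real) / 2 ^ Suc i \<le> 1"
    using one_le_power[of "2::real" "Suc i"] by (simp del: power_Suc)
  then show ?case using Suc unfolding odd_exp.simps even_exp.simps by linarith
qed (use assms in auto)

lemma exp_upper:
  assumes "\<theta> \<le> 2"
  shows "odd_exp \<theta> i \<le> real i + 2 \<and> even_exp \<theta> i \<le> real i + 2"
proof (induction i)
  case (Suc i)
  have "(1::real) / 2 ^ Suc i \<ge> 0" by simp
  then show ?case using Suc unfolding odd_exp.simps even_exp.simps of_nat_Suc by linarith
qed (use assms in auto)

lemma max_exp_Suc:
  "max (odd_exp \<theta> i) (even_exp \<theta> i) + 1 / 2 \<le> even_exp \<theta> (Suc i)"
proof -
  have "(1::real) \<le> 2 ^ i" by simp
  then have "(1::real) / 2 ^ Suc i \<le> 1 / 2" by (simp add: field_simps)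
  then show ?thesis by simp
qed

text \<open>Separates the levels: slacks of the bounds built on a level \<open>j < i\<close> have
  exponent at most \<open>1 + max\<close>, which stays 1/2 below the corresponding value at level
  \<open>i\<close>.\<close>

lemma max_exp_less:
  "i < j \<Longrightarrow> max (odd_exp \<theta> i) (even_exp \<theta> i) + 1 / 2 \<le> max (odd_exp \<theta> j) (even_exp \<theta> j)"
proof (induction j)
  case (Suc j)
  show ?case
  proof (cases "i = j")
    case False
    then show ?thesis using Suc max_exp_Suc[of \<theta> j] by linarith
  next
    case True
    show ?thesis unfolding True using max_exp_Suc[of \<theta> j] by linarith
  qed
qed simp

text \<open>The value is 1 from \<open>even_exp\<close> at level 0 plus the gap 1/2. One more unit
  puts the dominating slack above \<open>t powr 2\<close>, the order of the slack of
  \<open>X 1 \<le> t ^ 2\<close>, and above the dual variables.\<close>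

lemma max_exp_ge: "i \<ge> 1 \<Longrightarrow> max (odd_exp \<theta> i) (even_exp \<theta> i) \<ge> 3 / 2"
  using max_exp_less[of 0 i \<theta>] by simp

section \<open>Feasible points of \<open>LW\<^sub>r(t)\<close>\<close>

lemma lw_carriers [simp]:
  "lw_A r t \<in> carrier_mat (3 * r - 1) (2 * r)" "lw_b r t \<in> carrier_vec (3 * r - 1)"
  "lw_c r \<in> carrier_vec (2 * r)"
  "dim_row (lw_A r t) = 3 * r - 1" "dim_col (lw_A r t) = 2 * r" "dim_vec (lw_b r t) = 3 * r - 1"
  by (simp_all add: lw_A_def lw_b_def lw_c_def)

text \<open>The constraint index \<open>j\<close> is written \<open>Suc i\<close>, which matches the
  recursion of the exponents and removes subtraction on \<open>nat\<close> from the row and column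
  numbers.\<close>

lemma lw_slack:
  assumes r: "r \<ge> 1" and x: "x \<in> carrier_vec (2 * r)" and w: "w \<in> carrier_vec (3 * r - 1)"
    and eq: "lw_A r t *\<^sub>v x + w = lw_b r t"
  shows "w $ 0 = t ^ 2 - x $ 0" "w $ 1 = t - x $ 1"
    and "Suc i < r \<Longrightarrow> w $ (3 * i + 2) = t * x $ (2 * i) - x $ (2 * i + 2)"
    and "Suc i < r \<Longrightarrow> w $ (3 * i + 3) = t * x $ (2 * i + 1) - x $ (2 * i + 2)"
    and "Suc i < r \<Longrightarrow>
      w $ (3 * i + 4) = t powr (1 - 1 / 2 ^ Suc i) * (x $ (2 * i) + x $ (2 * i + 1)) - x $ (2 * i + 3)"
proof -
  have row: "(lw_A r t *\<^sub>v x) $ k + w $ k = lw_b r t $ k" if "k < 3 * r - 1" for k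
    using that w by (simp flip: eq)
  have b: "lw_b r t $ k = (if k = 0 then t ^ 2 else if k = 1 then t else 0)" if "k < 3 * r - 1" for k
    using that by (simp add: lw_b_def)
  note R = lw_row[OF r x, where t = t]
  have k1: "1 < 3 * r - 1" using r by linarith
  show "w $ 0 = t ^ 2 - x $ 0" using row[of 0] R(1) b[of 0] r by simp
  show "w $ 1 = t - x $ 1" using row[OF k1] R(2) b[OF k1] by simp
  assume i: "Suc i < r"
  have kr: "3 * i + 2 < 3 * r - 1" "3 * i + 3 < 3 * r - 1" "3 * i + 4 < 3 * r - 1" using i by linarith+
  have k: "3 * Suc i - 1 = 3 * i + 2" "3 * Suc i = 3 * i + 3" "3 * Suc i + 1 = 3 * i + 4"
    "2 * Suc i - 2 = 2 * i" "2 * Suc i - 1 = 2 * i + 1" "2 * Suc i = 2 * i + 2" "2 * Suc i + 1 = 2 * i + 3"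
    "3 * i + 3 + 1 = 3 * i + 4" "2 * i + 2 - 2 = 2 * i" "2 * i + 2 - 1 = 2 * i + 1" "2 * i + 2 + 1 = 2 * i + 3"
    by auto
  have i1: "1 \<le> Suc i" by simp
  show "w $ (3 * i + 2) = t * x $ (2 * i) - x $ (2 * i + 2)"
    using row[OF kr(1)] b[OF kr(1)] i R(3)[OF i1 i, unfolded k] by simp
  show "w $ (3 * i + 3) = t * x $ (2 * i + 1) - x $ (2 * i + 2)"
    using row[OF kr(2)] b[OF kr(2)] i R(4)[OF i1 i, unfolded k] by simp
  show "w $ (3 * i + 4) = t powr (1 - 1 / 2 ^ Suc i) * (x $ (2 * i) + x $ (2 * i + 1)) - x $ (2 * i + 3)"
    using row[OF kr(3)] b[OF kr(3)] i R(5)[OF i1 i, unfolded k] by simp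
qed

lemma lw_col_cases:
  fixes k :: nat
  assumes "k < 2 * r"
  obtains i where "i < r" "k = 2 * i" | i where "i < r" "k = 2 * i + 1"
proof (cases "even k")
  case True
  then show ?thesis using assms that(1)[of "k div 2"] by auto
next
  case False
  then show ?thesis using assms that(2)[of "k div 2"] by auto
qed

lemma lw_row_cases:
  assumes "k < 3 * r - 1"
  obtains "k = 0" | "k = 1" | i where "Suc i < r" "k = 3 * i + 2"
    | i where "Suc i < r" "k = 3 * i + 3" | i where "Suc i < r" "k = 3 * i + 4"
proof -
  consider "k = 0" | "k = 1" | "k \<ge> 2" by linarith
  then show ?thesis
  proof cases
    case 3
    define i where "i = (k - 2) div 3"
    have i: "Suc i < r" using assms 3 unfolding i_def by linarith
    have "k = 3 * i + 2 \<or> k = 3 * i + 3 \<or> k = 3 * i + 4"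
      using 3 unfolding i_def by linarith
    then show ?thesis using that(3-5)[OF i] by blast
  qed (use that in auto)
qed

text \<open>The constraints propagate a bound on \<open>X 1\<close> through the max-plus recursion.
  A sum of two variables is at most twice the larger order, hence one factor 2 per level.\<close>

lemma lw_feasible_upper:
  assumes r: "r \<ge> 1" and x: "x \<in> carrier_vec (2 * r)" and w: "w \<in> carrier_vec (3 * r - 1)"
    and eq: "lw_A r t *\<^sub>v x + w = lw_b r t"
    and wnn: "\<And>k. k < 3 * r - 1 \<Longrightarrow> w $ k \<ge> 0"
    and t: "t \<ge> 1" and c: "c \<ge> 1" and x0: "x $ 0 \<le> c * t powr \<theta>"
  shows "i < r \<Longrightarrow> x $ (2 * i) \<le> c * 2 ^ i * t powr odd_exp \<theta> i \<and>
    x $ (2 * i + 1) \<le> c * 2 ^ i * t powr even_exp \<theta> i"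
proof (induction i)
  case 0
  have "x $ 1 \<le> t" using wnn[of 1] lw_slack(2)[OF r x w eq] r by simp
  also have "t \<le> c * t" using c t by simp
  finally show ?case using x0 t by simp
next
  case (Suc i)
  note sl = lw_slack(3-5)[OF r x w eq Suc.prems]
  have wk: "w $ (3 * i + 2) \<ge> 0" "w $ (3 * i + 3) \<ge> 0" "w $ (3 * i + 4) \<ge> 0"
    using Suc.prems by (auto intro!: wnn)
  let ?o = "odd_exp \<theta> i" and ?e = "even_exp \<theta> i"
  have IH: "x $ (2 * i) \<le> c * 2 ^ i * t powr ?o" "x $ (2 * i + 1) \<le> c * 2 ^ i * t powr ?e"
    using Suc by auto
  have mult: "t * (c * 2 ^ i * t powr a) = c * 2 ^ i * t powr (1 + a)" for a
    using t by (simp add: powr_add)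
  have "t * x $ (2 * i) \<le> t * (c * 2 ^ i * t powr ?o)" using IH(1) t by (intro mult_left_mono) auto
  then have 1: "x $ (2 * i + 2) \<le> c * 2 ^ i * t powr (1 + ?o)"
    using sl(1) wk(1) unfolding mult by linarith
  have "t * x $ (2 * i + 1) \<le> t * (c * 2 ^ i * t powr ?e)" using IH(2) t by (intro mult_left_mono) auto
  then have 2: "x $ (2 * i + 2) \<le> c * 2 ^ i * t powr (1 + ?e)"
    using sl(2) wk(2) unfolding mult by linarith
  have "x $ (2 * i + 2) \<le> c * 2 ^ i * t powr (1 + min ?o ?e)"
    using 1 2 by (simp add: min_def)
  also have "\<dots> \<le> c * 2 ^ Suc i * t powr (1 + min ?o ?e)"
    using c by (intro mult_right_mono) auto
  finally have odd: "x $ (2 * i + 2) \<le> c * 2 ^ Suc i * t powr (1 + min ?o ?e)" .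
  have "t powr ?o \<le> t powr max ?o ?e" "t powr ?e \<le> t powr max ?o ?e"
    using t by (auto intro!: powr_mono)
  then have "c * 2 ^ i * t powr ?o \<le> c * 2 ^ i * t powr max ?o ?e"
      "c * 2 ^ i * t powr ?e \<le> c * 2 ^ i * t powr max ?o ?e"
    using c by (auto intro!: mult_left_mono)
  then have "x $ (2 * i) + x $ (2 * i + 1) \<le> c * 2 ^ Suc i * t powr max ?o ?e"
    using IH by simp
  then have "t powr (1 - 1 / 2 ^ Suc i) * (x $ (2 * i) + x $ (2 * i + 1)) \<le>
      t powr (1 - 1 / 2 ^ Suc i) * (c * 2 ^ Suc i * t powr max ?o ?e)"
    by (intro mult_left_mono) auto
  also have "\<dots> = c * 2 ^ Suc i * t powr even_exp \<theta> (Suc i)"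
    unfolding even_exp.simps powr_add by (simp only: mult_ac)
  finally have even: "x $ (2 * i + 3) \<le> c * 2 ^ Suc i * t powr even_exp \<theta> (Suc i)"
    using sl(3) wk(3) by linarith
  show ?case using odd even by (simp add: eval_nat_numeral)
qed

text \<open>Crude bounds independent of \<mu>. They give the compactness needed for existence, and
  they control the primal part when \<mu> exceeds \<open>t ^ 2\<close>, where the exponents no
  longer apply.\<close>

lemma lw_feasible_bounded:
  assumes r: "r \<ge> 1" and x: "x \<in> carrier_vec (2 * r)" and w: "w \<in> carrier_vec (3 * r - 1)"
    and eq: "lw_A r t *\<^sub>v x + w = lw_b r t"
    and xnn: "\<And>j. j < 2 * r \<Longrightarrow> x $ j \<ge> 0" and wnn: "\<And>i. i < 3 * r - 1 \<Longrightarrow> w $ i \<ge> 0"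
    and t: "t \<ge> 1"
  shows "j < 2 * r \<Longrightarrow> x $ j \<le> 2 ^ r * t powr (real r + 1)"
    "i < 3 * r - 1 \<Longrightarrow> w $ i \<le> 2 ^ Suc r * t powr (real r + 2)"
proof -
  define B where "B = 2 ^ r * t powr (real r + 1)"
  \<comment> \<open>The first constraint alone puts every feasible point in the case \<theta> = 2 of
    the propagation.\<close>
  have "x $ 0 \<le> 1 * t powr 2"
    using lw_slack(1)[OF r x w eq] wnn[of 0] r t by (simp add: powr_numeral)
  note U = lw_feasible_upper[OF r x w eq wnn t order_refl this]
  have le: "1 * 2 ^ i * t powr a \<le> B" if "i < r" "a \<le> real i + 2" for i a
    using that t unfolding B_def by (intro mult_mono powr_mono) (auto intro!: power_increasing)
  have xB: "x $ j \<le> B" if "j < 2 * r" for j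
    using that
  proof (rule lw_col_cases)
    fix i assume i: "i < r"
    note E = exp_upper[of 2 i]
    show ?thesis if "j = 2 * i"
      using U[of i] i le[OF i, of "odd_exp 2 i"] E unfolding that by force
    show ?thesis if "j = 2 * i + 1"
      using U[of i] i le[OF i, of "even_exp 2 i"] E unfolding that by force
  qed
  then show "j < 2 * r \<Longrightarrow> x $ j \<le> 2 ^ r * t powr (real r + 1)" unfolding B_def .
  have "1 * t powr 1 \<le> B" unfolding B_def using t r by (intro mult_mono powr_mono) auto
  then have tB: "t \<le> B" using t by simp
  have "t * 1 \<le> t * B" using tB t by (intro mult_left_mono) auto
  moreover have "t * t \<le> t * B" using tB t by (intro mult_left_mono) auto
  ultimately have ttB: "t \<le> 2 * t * B" "t ^ 2 \<le> 2 * t * B" using t tB by (auto simp: power2_eq_square)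
  have w_le: "w $ i \<le> 2 * t * B" if "i < 3 * r - 1"
    using that
  proof (rule lw_row_cases)
    have r0: "0 < 2 * r" "1 < 2 * r" using r by linarith+
    show ?thesis if "i = 0" using lw_slack(1)[OF r x w eq] xnn[OF r0(1)] ttB(2) that by simp
    show ?thesis if "i = 1" using lw_slack(2)[OF r x w eq] xnn[OF r0(2)] ttB(1) that by simp
    fix k assume k: "Suc k < r"
    then have k': "2 * k < 2 * r" "2 * k + 1 < 2 * r" "2 * k + 2 < 2 * r" "2 * k + 3 < 2 * r" by linarith+
    note xk = k'[THEN xnn] k'[THEN xB]
    note sl = lw_slack(3-5)[OF r x w eq k]
    have m: "t * x $ (2 * k) \<le> t * B" "t * x $ (2 * k + 1) \<le> t * B" "t * B \<le> 2 * t * B"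
      using xk t tB by (auto intro!: mult_left_mono)
    show ?thesis if "i = 3 * k + 2" unfolding that using sl(1) xk(3) m by linarith
    show ?thesis if "i = 3 * k + 3" unfolding that using sl(2) xk(3) m by linarith
    have "t powr (1 - 1 / 2 ^ Suc k) \<le> t powr 1" using t by (intro powr_mono) auto
    then have "t powr (1 - 1 / 2 ^ Suc k) * (x $ (2 * k) + x $ (2 * k + 1)) \<le> t * (B + B)"
      using xk t by (intro mult_mono add_mono) auto
    then show ?thesis if "i = 3 * k + 4" unfolding that using sl(3) xk(4) by (simp add: algebra_simps)
  qed
  have "2 * t * B = 2 ^ Suc r * t powr (real r + 2)"
    using t powr_add[of t "real r + 1" 1] by (simp add: B_def add.commute)
  then show "i < 3 * r - 1 \<Longrightarrow> w $ i \<le> 2 ^ Suc r * t powr (real r + 2)" using w_le by simp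
qed

text \<open>The exponents are those at which the bounds on all variables except \<open>X 1\<close>
  are saturated in order. The extra factor 1/2 at each level leaves room for slacks of the same
  order as the bounds.\<close>

definition lw_test :: "nat \<Rightarrow> real \<Rightarrow> real \<Rightarrow> real vec" where
  "lw_test r t \<theta> = vec (2 * r) (\<lambda>k.
     t powr (if even k then odd_exp \<theta> (k div 2) else even_exp \<theta> (k div 2)) / 2 ^ Suc (k div 2))"

definition lw_test_slack :: "nat \<Rightarrow> real \<Rightarrow> real \<Rightarrow> real vec" where
  "lw_test_slack r t \<theta> = lw_b r t - lw_A r t *\<^sub>v lw_test r t \<theta>"

lemma lw_test_index:
  "i < r \<Longrightarrow> lw_test r t \<theta> $ (2 * i) = t powr odd_exp \<theta> i / 2 ^ Suc i"
  "i < r \<Longrightarrow> lw_test r t \<theta> $ (2 * i + 1) = t powr even_exp \<theta> i / 2 ^ Suc i"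
  by (simp_all add: lw_test_def)

lemma lw_test_feasible:
  "lw_test r t \<theta> \<in> carrier_vec (2 * r)" "lw_test_slack r t \<theta> \<in> carrier_vec (3 * r - 1)"
  "lw_A r t *\<^sub>v lw_test r t \<theta> + lw_test_slack r t \<theta> = lw_b r t"
proof -
  show "lw_test r t \<theta> \<in> carrier_vec (2 * r)" by (simp add: lw_test_def)
  have "lw_A r t *\<^sub>v lw_test r t \<theta> \<in> carrier_vec (3 * r - 1)" by (intro carrier_vecI) simp
  then show "lw_test_slack r t \<theta> \<in> carrier_vec (3 * r - 1)"
    "lw_A r t *\<^sub>v lw_test r t \<theta> + lw_test_slack r t \<theta> = lw_b r t"
    unfolding lw_test_slack_def by (auto intro!: eq_vecI carrier_vecI)
qed

text \<open>Each variable uses at most half of its upper bound, so the slack retains at least the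
  other half. For the bound on \<open>X 1\<close> this is where \<open>\<theta> \<le> 2\<close>
  enters.\<close>

lemma lw_test_slack_ge:
  assumes r: "r \<ge> 1" and t: "t \<ge> 1" and \<theta>: "\<theta> \<le> 2"
  shows "t powr 2 / 2 \<le> lw_test_slack r t \<theta> $ 0" "t / 2 \<le> lw_test_slack r t \<theta> $ 1"
    and "Suc i < r \<Longrightarrow> t powr (1 + odd_exp \<theta> i) / 2 ^ (i + 2) \<le> lw_test_slack r t \<theta> $ (3 * i + 2)"
    and "Suc i < r \<Longrightarrow> t powr (1 + even_exp \<theta> i) / 2 ^ (i + 2) \<le> lw_test_slack r t \<theta> $ (3 * i + 3)"
    and "Suc i < r \<Longrightarrow> t powr even_exp \<theta> (Suc i) / 2 ^ (i + 2) \<le> lw_test_slack r t \<theta> $ (3 * i + 4)"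
proof -
  note sl = lw_slack[OF r lw_test_feasible]
  have t0: "t > 0" using t by simp
  have mono: "t powr a \<le> t powr b" if "a \<le> b" for a b using that t by (rule powr_mono)
  have "t powr \<theta> \<le> t\<^sup>2" using mono[OF \<theta>] t0 by (simp add: powr_numeral)
  then show "t powr 2 / 2 \<le> lw_test_slack r t \<theta> $ 0"
    unfolding sl(1) using lw_test_index(1)[of 0 r t \<theta>] r t0 by (simp add: powr_numeral)
  show "t / 2 \<le> lw_test_slack r t \<theta> $ 1"
    unfolding sl(2) using lw_test_index(2)[of 0 r t \<theta>] r t0 by simp
  assume i: "Suc i < r"
  let ?o = "odd_exp \<theta> i" and ?e = "even_exp \<theta> i"
  have xi: "lw_test r t \<theta> $ (2 * i) = t powr ?o / 2 ^ Suc i"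
    "lw_test r t \<theta> $ (2 * i + 1) = t powr ?e / 2 ^ Suc i"
    using lw_test_index[of i r t \<theta>] i by simp_all
  have xS: "lw_test r t \<theta> $ (2 * i + 2) = t powr (1 + min ?o ?e) / 2 ^ (i + 2)"
    "lw_test r t \<theta> $ (2 * i + 3) = t powr even_exp \<theta> (Suc i) / 2 ^ (i + 2)"
    using lw_test_index[of "Suc i" r t \<theta>] i by (simp_all add: eval_nat_numeral)
  have mult: "t * t powr a = t powr (1 + a)" for a using t0 by (simp add: powr_add)
  have "t powr (1 + min ?o ?e) \<le> t powr (1 + ?o)" by (intro mono) simp
  then show "t powr (1 + ?o) / 2 ^ (i + 2) \<le> lw_test_slack r t \<theta> $ (3 * i + 2)"
    unfolding sl(3)[OF i] xi xS by (simp add: mult field_simps)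
  have "t powr (1 + min ?o ?e) \<le> t powr (1 + ?e)" by (intro mono) simp
  then show "t powr (1 + ?e) / 2 ^ (i + 2) \<le> lw_test_slack r t \<theta> $ (3 * i + 3)"
    unfolding sl(4)[OF i] xi xS by (simp add: mult field_simps)
  have "t powr max ?o ?e \<le> t powr ?o + t powr ?e" by (simp add: max_def)
  then have "t powr (1 - 1 / 2 ^ Suc i) * t powr max ?o ?e \<le>
      t powr (1 - 1 / 2 ^ Suc i) * (t powr ?o + t powr ?e)"
    by (intro mult_left_mono) auto
  then have "t powr even_exp \<theta> (Suc i) / 2 ^ Suc i \<le>
      t powr (1 - 1 / 2 ^ Suc i) * (t powr ?o / 2 ^ Suc i + t powr ?e / 2 ^ Suc i)"
    unfolding even_exp.simps powr_add by (simp add: field_simps)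
  then show "t powr even_exp \<theta> (Suc i) / 2 ^ (i + 2) \<le> lw_test_slack r t \<theta> $ (3 * i + 4)"
    unfolding sl(5)[OF i] xi xS by simp
qed

lemma lw_test_pos:
  assumes "r \<ge> 1" "t \<ge> 1" "\<theta> \<le> 2"
  shows "j < 2 * r \<Longrightarrow> lw_test r t \<theta> $ j > 0" "i < 3 * r - 1 \<Longrightarrow> lw_test_slack r t \<theta> $ i > 0"
proof -
  show "lw_test r t \<theta> $ j > 0" if "j < 2 * r" using that assms by (simp add: lw_test_def)
  have *: "t powr a / 2 ^ k > 0" "t powr a / 2 > 0" "t / 2 > 0" for a k using assms by auto
  note T = lw_test_slack_ge[OF assms]
  show "lw_test_slack r t \<theta> $ i > 0" if "i < 3 * r - 1"
    using that
  proof (rule lw_row_cases)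
    show ?thesis if "i = 0" using less_le_trans[OF *(2) T(1)] that by simp
    show ?thesis if "i = 1" using less_le_trans[OF *(3) T(2)] that by simp
    fix k assume k: "Suc k < r"
    show ?thesis if "i = 3 * k + 2" using less_le_trans[OF *(1) T(3)[OF k]] that by blast
    show ?thesis if "i = 3 * k + 3" using less_le_trans[OF *(1) T(4)[OF k]] that by blast
    show ?thesis if "i = 3 * k + 4" using less_le_trans[OF *(1) T(5)[OF k]] that by blast
  qed
qed

lemma lw_central_path_exists:
  assumes r: "r \<ge> 1" and t: "t \<ge> 1" and \<mu>: "\<mu> > 0"
  obtains x w s y where "central_path_system (lw_A r t) (lw_b r t) (lw_c r) \<mu> x w s y"
    "lw_central_path r t \<mu> = x @\<^sub>v w @\<^sub>v s @\<^sub>v y"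
proof -
  have "\<exists>x w s y. central_path_system (lw_A r t) (lw_b r t) (lw_c r) \<mu> x w s y"
  \<comment> \<open>The exponent 0 is an arbitrary choice: the test point is strictly feasible for
    every exponent up to 2, whatever the value of \<mu>.\<close>
  proof (rule central_path_system_exists[where ?x0.0 = "lw_test r t 0" and B = "2 ^ r * t powr (real r + 1)"])
    show "(lw_A r t *\<^sub>v lw_test r t 0) $ i < lw_b r t $ i" if "i < 3 * r - 1" for i
      using lw_test_pos(2)[OF r t _ that, of 0] that by (simp add: lw_test_slack_def)
    fix x j assume x: "x \<in> carrier_vec (2 * r)" "\<And>j. j < 2 * r \<Longrightarrow> x $ j \<ge> 0"
      "\<And>i. i < 3 * r - 1 \<Longrightarrow> (lw_A r t *\<^sub>v x) $ i \<le> lw_b r t $ i" and j: "j < 2 * r"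
    define w where "w = lw_b r t - lw_A r t *\<^sub>v x"
    have w: "w \<in> carrier_vec (3 * r - 1)" "lw_A r t *\<^sub>v x + w = lw_b r t"
      "\<And>k. k < 3 * r - 1 \<Longrightarrow> w $ k \<ge> 0"
      using x by (auto simp: w_def intro!: eq_vecI carrier_vecI)
    show "x $ j \<le> 2 ^ r * t powr (real r + 1)"
      by (rule lw_feasible_bounded(1)[OF r x(1) w(1,2) x(2) w(3) t j])
  qed (use lw_test_pos(1)[OF r t] lw_test_feasible(1) lw_carriers \<mu> in \<open>auto simp del: lw_carriers\<close>)
  then obtain x w s y where *: "central_path_system (lw_A r t) (lw_b r t) (lw_c r) \<mu> x w s y" by blast
  show ?thesis
    by (rule that[OF *]) (simp add: lw_central_path_def central_path_eq[OF * lw_carriers(1,3) \<mu>])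
qed

section \<open>Orders of magnitude on the central path\<close>

locale lw_central_point =
  fixes r :: nat and t \<theta> :: real and x w s y :: "real vec"
  assumes r: "r \<ge> 1" and t: "t \<ge> 1" and \<theta>: "0 \<le> \<theta>" "\<theta> \<le> 2"
    and sys: "central_path_system (lw_A r t) (lw_b r t) (lw_c r) (t powr \<theta>) x w s y"
begin

text \<open>The factor \<open>5 r\<close> comes from the gap identity with its
  \<open>5 r - 1\<close> complementary pairs, \<open>2 ^ r\<close> from the losses over the levels,
  and the remaining 2 from sums of two variables in the slacks.\<close>

definition C :: real where "C = 10 * real r * 2 ^ r"

lemma carriers:
  "x \<in> carrier_vec (2 * r)" "w \<in> carrier_vec (3 * r - 1)"
  "s \<in> carrier_vec (2 * r)" "y \<in> carrier_vec (3 * r - 1)"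
  and primal: "lw_A r t *\<^sub>v x + w = lw_b r t"
  and complementary: "j < 2 * r \<Longrightarrow> x $ j * s $ j = t powr \<theta>" "i < 3 * r - 1 \<Longrightarrow> w $ i * y $ i = t powr \<theta>"
  and pos: "j < 2 * r \<Longrightarrow> x $ j > 0" "j < 2 * r \<Longrightarrow> s $ j > 0"
    "i < 3 * r - 1 \<Longrightarrow> w $ i > 0" "i < 3 * r - 1 \<Longrightarrow> y $ i > 0"
  using sys unfolding central_path_system_def by auto

lemmas slack = lw_slack[OF r carriers(1,2) primal]

lemma gap:
  assumes "x' \<in> carrier_vec (2 * r)" "w' \<in> carrier_vec (3 * r - 1)" "lw_A r t *\<^sub>v x' + w' = lw_b r t"
  shows "(\<Sum>j<2 * r. x' $ j * s $ j) + (\<Sum>i<3 * r - 1. w' $ i * y $ i) =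
    x' $ 0 - x $ 0 + (5 * real r - 1) * t powr \<theta>"
proof -
  have "real (2 * r + (3 * r - 1)) = 5 * real r - 1" using r by (simp add: of_nat_diff)
  then show ?thesis
    using central_path_gap[OF sys lw_carriers(1,3) assms] lw_objective[OF r] carriers(1) assms(1)
    by simp
qed

text \<open>The origin with slack \<open>lw_b\<close> is feasible and has objective 0. Its left side
  in the gap identity is nonnegative, which bounds the optimality gap of \<open>x\<close>.\<close>

lemma x0_le: "x $ 0 \<le> 5 * real r * t powr \<theta>"
proof -
  have "lw_A r t *\<^sub>v 0\<^sub>v (2 * r) + lw_b r t = lw_b r t"
    by (rule eq_vecI) (auto simp: scalar_prod_def)
  note g = gap[OF zero_carrier_vec lw_carriers(2) this]
  have "(\<Sum>i<3 * r - 1. lw_b r t $ i * y $ i) \<ge> 0"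
    using pos(4) t by (intro sum_nonneg mult_nonneg_nonneg) (auto simp: lw_b_def less_imp_le)
  moreover have "(\<Sum>j<2 * r. 0\<^sub>v (2 * r) $ j * s $ j) = 0" by simp
  moreover have "0\<^sub>v (2 * r) $ 0 = (0::real)" using r by simp
  ultimately have "x $ 0 \<le> (5 * real r - 1) * t powr \<theta>" using g by linarith
  also have "\<dots> \<le> 5 * real r * t powr \<theta>" by (intro mult_right_mono) auto
  finally show ?thesis .
qed

text \<open>The objective of the test point is at most \<mu>, so the right side of the gap identity
  is at most \<open>5 r \<mu>\<close>. All terms on the left are nonnegative, hence each one obeys
  this bound, and by complementarity it is \<mu> times a ratio of test coordinate to central
  coordinate.\<close>

lemma ge_test:
  "j < 2 * r \<Longrightarrow> lw_test r t \<theta> $ j \<le> 5 * real r * x $ j"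
  "i < 3 * r - 1 \<Longrightarrow> lw_test_slack r t \<theta> $ i \<le> 5 * real r * w $ i"
proof -
  let ?x = "lw_test r t \<theta>" and ?w = "lw_test_slack r t \<theta>"
  have "0 < 2 * r" using r by simp
  then have "x $ 0 > 0" by (rule pos)
  moreover have "?x $ 0 \<le> t powr \<theta>" using r by (simp add: lw_test_def)
  ultimately have le: "(\<Sum>j<2 * r. ?x $ j * s $ j) + (\<Sum>i<3 * r - 1. ?w $ i * y $ i) \<le>
      5 * real r * t powr \<theta>"
    unfolding gap[OF lw_test_feasible] by (simp add: algebra_simps)
  have nn: "?x $ j * s $ j \<ge> 0" if "j < 2 * r" for j
    using lw_test_pos(1)[OF r t \<theta>(2) that] pos(2)[OF that] by simp
  have wnn: "?w $ i * y $ i \<ge> 0" if "i < 3 * r - 1" for i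
    using lw_test_pos(2)[OF r t \<theta>(2) that] pos(4)[OF that] by simp
  have sums: "(\<Sum>j<2 * r. ?x $ j * s $ j) \<ge> 0" "(\<Sum>i<3 * r - 1. ?w $ i * y $ i) \<ge> 0"
    using nn wnn by (auto intro!: sum_nonneg)
  show "?x $ j \<le> 5 * real r * x $ j" if j: "j < 2 * r" for j
  proof -
    have "?x $ j * s $ j \<le> (\<Sum>j<2 * r. ?x $ j * s $ j)"
      using j nn by (intro member_le_sum) auto
    then have "?x $ j * s $ j \<le> (5 * real r * x $ j) * s $ j"
      using le sums complementary(1)[OF j] by (simp add: mult.assoc)
    then show ?thesis using pos(2)[OF j] by simp
  qed
  show "?w $ i \<le> 5 * real r * w $ i" if i: "i < 3 * r - 1" for i
  proof -
    have "?w $ i * y $ i \<le> (\<Sum>i<3 * r - 1. ?w $ i * y $ i)"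
      using i wnn by (intro member_le_sum) auto
    then have "?w $ i * y $ i \<le> (5 * real r * w $ i) * y $ i"
      using le sums complementary(2)[OF i] by (simp add: mult.assoc)
    then show ?thesis using pos(4)[OF i] by simp
  qed
qed

lemma C_ge: "C \<ge> 10"
proof -
  have "10 * 1 * 1 \<le> 10 * real r * 2 ^ r" using r by (intro mult_mono) auto
  then show ?thesis by (simp add: C_def)
qed

lemma div_C_le:
  assumes "a / 2 ^ k \<le> 5 * real r * z" "k \<le> r" "z > 0"
  shows "a \<le> C * z"
proof -
  have "a \<le> 5 * real r * z * 2 ^ k" using assms(1) by (simp add: field_simps)
  also have "\<dots> \<le> 5 * real r * z * 2 ^ r"
    using assms by (intro mult_left_mono power_increasing) auto
  also have "\<dots> \<le> C * z" using assms(3) by (simp add: C_def)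
  finally show ?thesis .
qed

lemma col_lower:
  assumes i: "i < r"
  shows "t powr odd_exp \<theta> i \<le> C * x $ (2 * i)" "t powr even_exp \<theta> i \<le> C * x $ (2 * i + 1)"
  using ge_test(1)[of "2 * i"] ge_test(1)[of "2 * i + 1"] lw_test_index[OF i, of t \<theta>] pos(1) i
  by (auto intro!: div_C_le[of _ "Suc i"])

lemma row_lower:
  "t powr 2 \<le> C * w $ 0" "t \<le> C * w $ 1"
  "Suc i < r \<Longrightarrow> t powr (1 + odd_exp \<theta> i) \<le> C * w $ (3 * i + 2)"
  "Suc i < r \<Longrightarrow> t powr (1 + even_exp \<theta> i) \<le> C * w $ (3 * i + 3)"
  "Suc i < r \<Longrightarrow> t powr even_exp \<theta> (Suc i) \<le> C * w $ (3 * i + 4)"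
proof -
  note T = lw_test_slack_ge[OF r t \<theta>(2)]
  have k: "0 < 3 * r - 1" "1 < 3 * r - 1" using r by linarith+
  show "t powr 2 \<le> C * w $ 0"
    by (rule div_C_le[of _ 1]) (use T(1) ge_test(2)[OF k(1)] pos(3)[OF k(1)] r in auto)
  show "t \<le> C * w $ 1"
    by (rule div_C_le[of _ 1]) (use T(2) ge_test(2)[OF k(2)] pos(3)[OF k(2)] r in auto)
  assume i: "Suc i < r"
  then have k: "3 * i + 2 < 3 * r - 1" "3 * i + 3 < 3 * r - 1" "3 * i + 4 < 3 * r - 1" "i + 2 \<le> r"
    by linarith+
  show "t powr (1 + odd_exp \<theta> i) \<le> C * w $ (3 * i + 2)"
    by (rule div_C_le[OF order_trans[OF T(3)[OF i] ge_test(2)[OF k(1)]] k(4) pos(3)[OF k(1)]])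
  show "t powr (1 + even_exp \<theta> i) \<le> C * w $ (3 * i + 3)"
    by (rule div_C_le[OF order_trans[OF T(4)[OF i] ge_test(2)[OF k(2)]] k(4) pos(3)[OF k(2)]])
  show "t powr even_exp \<theta> (Suc i) \<le> C * w $ (3 * i + 4)"
    by (rule div_C_le[OF order_trans[OF T(5)[OF i] ge_test(2)[OF k(3)]] k(4) pos(3)[OF k(3)]])
qed

lemma col_upper:
  assumes i: "i < r"
  shows "x $ (2 * i) \<le> C / 2 * t powr odd_exp \<theta> i" "x $ (2 * i + 1) \<le> C / 2 * t powr even_exp \<theta> i"
proof -
  have c: "1 \<le> 5 * real r" using r by simp
  have nn: "w $ k \<ge> 0" if "k < 3 * r - 1" for k using pos(3)[OF that] by simp
  have le: "5 * real r * 2 ^ i * t powr a \<le> C / 2 * t powr a" for a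
    unfolding C_def using i by (intro mult_right_mono) (auto intro!: mult_left_mono power_increasing)
  note U = lw_feasible_upper[OF r carriers(1,2) primal nn t c x0_le i]
  show "x $ (2 * i) \<le> C / 2 * t powr odd_exp \<theta> i"
    using U le[of "odd_exp \<theta> i"] by linarith
  show "x $ (2 * i + 1) \<le> C / 2 * t powr even_exp \<theta> i"
    using U le[of "even_exp \<theta> i"] by linarith
qed

lemma row_upper:
  "w $ 0 \<le> t powr 2" "w $ 1 \<le> t"
  "Suc i < r \<Longrightarrow> w $ (3 * i + 2) \<le> C * t powr (1 + odd_exp \<theta> i)"
  "Suc i < r \<Longrightarrow> w $ (3 * i + 3) \<le> C * t powr (1 + even_exp \<theta> i)"
  "Suc i < r \<Longrightarrow> w $ (3 * i + 4) \<le> C * t powr even_exp \<theta> (Suc i)"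
proof -
  have k: "0 < 2 * r" "1 < 2 * r" using r by linarith+
  show "w $ 0 \<le> t powr 2" using slack(1) pos(1)[OF k(1)] t by (simp add: powr_numeral)
  show "w $ 1 \<le> t" using slack(2) pos(1)[OF k(2)] by simp
  assume i: "Suc i < r"
  have k: "2 * i + 2 < 2 * r" "2 * i + 3 < 2 * r" "i < r" using i by linarith+
  note xp = pos(1)[OF k(1)] pos(1)[OF k(2)]
  let ?o = "odd_exp \<theta> i" and ?e = "even_exp \<theta> i"
  have mult: "t * (C / 2 * t powr a) \<le> C * t powr (1 + a)" for a
    using t C_ge by (simp add: powr_add)
  have "t * x $ (2 * i) \<le> t * (C / 2 * t powr ?o)"
    using t col_upper(1)[OF k(3)] by (intro mult_left_mono) auto
  then show "w $ (3 * i + 2) \<le> C * t powr (1 + ?o)"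
    using slack(3)[OF i] xp(1) mult[of ?o] by linarith
  have "t * x $ (2 * i + 1) \<le> t * (C / 2 * t powr ?e)"
    using t col_upper(2)[OF k(3)] by (intro mult_left_mono) auto
  then show "w $ (3 * i + 3) \<le> C * t powr (1 + ?e)"
    using slack(4)[OF i] xp(1) mult[of ?e] by linarith
  have "t powr ?o \<le> t powr max ?o ?e" "t powr ?e \<le> t powr max ?o ?e"
    using t by (auto intro!: powr_mono)
  then have "C / 2 * t powr ?o \<le> C / 2 * t powr max ?o ?e"
      "C / 2 * t powr ?e \<le> C / 2 * t powr max ?o ?e"
    using C_ge by (auto intro!: mult_left_mono)
  then have "x $ (2 * i) + x $ (2 * i + 1) \<le> C * t powr max ?o ?e"
    using col_upper[OF k(3)] by linarith
  then have "t powr (1 - 1 / 2 ^ Suc i) * (x $ (2 * i) + x $ (2 * i + 1)) \<le>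
      t powr (1 - 1 / 2 ^ Suc i) * (C * t powr max ?o ?e)"
    by (intro mult_left_mono) auto
  also have "\<dots> = C * t powr even_exp \<theta> (Suc i)"
    unfolding even_exp.simps powr_add by (simp only: mult_ac)
  finally show "w $ (3 * i + 4) \<le> C * t powr even_exp \<theta> (Suc i)"
    using slack(5)[OF i] xp(2) by linarith
qed

text \<open>Complementarity turns lower bounds on primal coordinates into upper bounds on dual ones,
  and no primal coordinate has order below \<open>t powr (\<theta> - 1)\<close>.\<close>

lemma dual_upper:
  "j < 2 * r \<Longrightarrow> s $ j \<le> C * t" "i < 3 * r - 1 \<Longrightarrow> y $ i \<le> C * t"
proof -
  have dual: "d \<le> C * t" if "t powr e \<le> C * p" "\<theta> - 1 \<le> e" "p * d = t powr \<theta>" "p > 0" "d > 0" for e p d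
  proof -
    have "p * d = t * t powr (\<theta> - 1)" using that(3) t by (simp add: powr_diff)
    also have "\<dots> \<le> t * (C * p)"
      using t powr_mono[OF that(2) t] that(1) by (intro mult_left_mono) auto
    finally have "p * d \<le> p * (C * t)" by (simp add: mult_ac)
    then show ?thesis using that(4) by simp
  qed
  note E = exp_lower[OF \<theta>(2)]
  show "s $ j \<le> C * t" if j: "j < 2 * r"
    using j
  proof (rule lw_col_cases)
    fix i assume i: "i < r"
    show ?thesis if k: "j = 2 * i"
      using dual[OF col_lower(1)[OF i] _ complementary(1)[OF j, unfolded k] pos(1,2)[OF j, unfolded k]] E k
      by blast
    show ?thesis if k: "j = 2 * i + 1"
      using dual[OF col_lower(2)[OF i] _ complementary(1)[OF j, unfolded k] pos(1,2)[OF j, unfolded k]] E k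
      by blast
  qed
  have E': "\<theta> - 1 \<le> 2" "\<theta> - 1 \<le> 1" "\<And>i. \<theta> - 1 \<le> 1 + odd_exp \<theta> i" "\<And>i. \<theta> - 1 \<le> 1 + even_exp \<theta> i"
    using E \<theta> by (simp, simp, smt (verit), smt (verit))
  show "y $ i \<le> C * t" if i: "i < 3 * r - 1"
    using i
  proof (rule lw_row_cases)
    note D = dual[OF _ _ complementary(2)[OF i] pos(3,4)[OF i]]
    show ?thesis if "i = 0" using D[OF row_lower(1)[folded that]] E' by blast
    show ?thesis if "i = 1" using D[of 1] row_lower(2) t E' that by simp
    fix k assume k: "Suc k < r"
    show ?thesis if "i = 3 * k + 2" using D[OF row_lower(3)[OF k, folded that]] E' by blast
    show ?thesis if "i = 3 * k + 3" using D[OF row_lower(4)[OF k, folded that]] E' by blast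
    show ?thesis if "i = 3 * k + 4" using D[OF row_lower(5)[OF k, folded that]] E by blast
  qed
qed

end

section \<open>Coordinates of the primal-dual vector and one step of the path\<close>

lemma append4_index:
  assumes "x \<in> carrier_vec n" "w \<in> carrier_vec m" "s \<in> carrier_vec n" "y \<in> carrier_vec m"
  shows "dim_vec (x @\<^sub>v w @\<^sub>v s @\<^sub>v y) = 2 * (n + m)"
    and "i < n \<Longrightarrow> (x @\<^sub>v w @\<^sub>v s @\<^sub>v y) $ i = x $ i"
    and "i < m \<Longrightarrow> (x @\<^sub>v w @\<^sub>v s @\<^sub>v y) $ (n + i) = w $ i"
    and "i < n \<Longrightarrow> (x @\<^sub>v w @\<^sub>v s @\<^sub>v y) $ (n + m + i) = s $ i"
    and "i < m \<Longrightarrow> (x @\<^sub>v w @\<^sub>v s @\<^sub>v y) $ (n + m + n + i) = y $ i"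
  using assms by (auto simp: less_diff_conv2)

lemma append4_cases:
  fixes k n m :: nat
  assumes "k < 2 * (n + m)"
  obtains i where "i < n" "k = i" | i where "i < m" "k = n + i"
    | i where "i < n" "k = n + m + i" | i where "i < m" "k = n + m + n + i"
proof -
  consider "k < n" | "n \<le> k" "k < n + m" | "n + m \<le> k" "k < n + m + n" | "n + m + n \<le> k" by linarith
  then show ?thesis
  proof cases
    case 1 then show ?thesis using that(1) by blast
  next
    case 2 then show ?thesis using that(2)[of "k - n"] by simp
  next
    case 3 then show ?thesis using that(3)[of "k - (n + m)"] by simp
  next
    case 4 then show ?thesis using that(4)[of "k - (n + m + n)"] assms by simp
  qed
qed

abbreviation lw_const :: "nat \<Rightarrow> real" where
  "lw_const r \<equiv> 10 * real r * 2 ^ r"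

lemma lw_central_path_dim:
  assumes "r \<ge> 1" "t \<ge> 1" "\<mu> > 0"
  shows "dim_vec (lw_central_path r t \<mu>) = 10 * r - 2"
proof -
  obtain x w s y where sys: "central_path_system (lw_A r t) (lw_b r t) (lw_c r) \<mu> x w s y"
    and z: "lw_central_path r t \<mu> = x @\<^sub>v w @\<^sub>v s @\<^sub>v y"
    using lw_central_path_exists[OF assms] by blast
  have "x \<in> carrier_vec (2 * r)" "w \<in> carrier_vec (3 * r - 1)"
    "s \<in> carrier_vec (2 * r)" "y \<in> carrier_vec (3 * r - 1)"
    using sys unfolding central_path_system_def by auto
  then show ?thesis unfolding z using assms(1) append4_index(1) by fastforce
qed

lemma lw_central_point_exists:
  assumes "r \<ge> 1" "t \<ge> 1" "0 \<le> \<theta>" "\<theta> \<le> 2"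
  obtains x w s y where "lw_central_point r t \<theta> x w s y"
    "lw_central_path r t (t powr \<theta>) = x @\<^sub>v w @\<^sub>v s @\<^sub>v y"
proof -
  have "t powr \<theta> > 0" using assms by simp
  then obtain x w s y where "central_path_system (lw_A r t) (lw_b r t) (lw_c r) (t powr \<theta>) x w s y"
    "lw_central_path r t (t powr \<theta>) = x @\<^sub>v w @\<^sub>v s @\<^sub>v y"
    using lw_central_path_exists[OF assms(1,2)] by blast
  then show ?thesis using that assms by (simp add: lw_central_point_def)
qed

text \<open>All coordinates of a central point are bounded by \<open>t powr E\<close>, up to a constant, except possibly
  the slacks of the two inequalities \<open>X (2 r - 1) \<le> t X (2 r - 3)\<close> and \<open>X (2 r - 1) \<le> t X (2 r - 2)\<close>,
  which are the largest coordinates.\<close>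

lemma lw_central_path_upper:
  assumes ri: "r = i + 2" "i \<ge> 1" and t: "t \<ge> 1" and \<theta>: "0 \<le> \<theta>" "\<theta> \<le> 2"
    and E: "2 \<le> E" "max (odd_exp \<theta> i) (even_exp \<theta> i) + 1 - 1 / 2 ^ Suc i \<le> E"
      "1 + min (odd_exp \<theta> i) (even_exp \<theta> i) \<le> E"
    and S: "2 * r + (3 * i + 2) \<in> S \<or> 1 + odd_exp \<theta> i \<le> E"
      "2 * r + (3 * i + 3) \<in> S \<or> 1 + even_exp \<theta> i \<le> E"
    and k: "k < 10 * r - 2" "k \<notin> S"
  shows "0 \<le> lw_central_path r t (t powr \<theta>) $ k" "lw_central_path r t (t powr \<theta>) $ k \<le> lw_const r * t powr E"
proof -
  have r1: "r \<ge> 1" using ri by simp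
  obtain x w s y where p: "lw_central_point r t \<theta> x w s y"
    and z: "lw_central_path r t (t powr \<theta>) = x @\<^sub>v w @\<^sub>v s @\<^sub>v y"
    using lw_central_point_exists[OF r1 t \<theta>] by blast
  interpret lw_central_point r t \<theta> x w s y by (rule p)
  let ?M = "max (odd_exp \<theta> i) (even_exp \<theta> i)"
  have half: "(1::real) / 2 ^ Suc i \<le> 1 / 2"
    using one_le_power[of "2::real" i] by (simp add: field_simps)
  have Mj: "max (odd_exp \<theta> j) (even_exp \<theta> j) + 1 / 2 \<le> ?M" if "j < i" for j
    using max_exp_less[OF that] .
  have col: "odd_exp \<theta> j \<le> E" "even_exp \<theta> j \<le> E" if jr: "j < r" for j
  proof -
    \<comment> \<open>Because \<open>r = i + 2\<close>, the level \<open>Suc i\<close> is the last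
      one; the second and third assumptions on \<open>E\<close> are exactly the bounds for its even
      and odd variable.\<close>
    consider "j < i" | "j = i" | "j = Suc i" using jr ri by linarith
    then have "odd_exp \<theta> j \<le> E \<and> even_exp \<theta> j \<le> E"
    proof cases
      case 1 then show ?thesis using Mj[OF 1] E(2) half by linarith
    next
      case 2
      have "?M \<le> E" using E(2) half by linarith
      then show ?thesis using 2 by simp
    next
      case 3 then show ?thesis using E(2,3) by simp
    qed
    then show "odd_exp \<theta> j \<le> E" "even_exp \<theta> j \<le> E" by auto
  qed
  have row: "1 + odd_exp \<theta> j \<le> E" "1 + even_exp \<theta> j \<le> E" if "j < i" for j
    using Mj[OF that] E(2) half by linarith+
  have bd: "C * t powr e \<le> C * t powr E" if "e \<le> E" for e
    using powr_mono[OF that t] C_ge by simp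
  have bd1: "C * t \<le> C * t powr E" using bd[of 1] E(1) t by simp
  have bd0: "t powr 2 \<le> C * t powr E" "t \<le> C * t powr E"
  proof -
    have "1 * t powr E \<le> C * t powr E" using C_ge by (intro mult_right_mono) auto
    moreover have "t powr 2 \<le> t powr E" using E(1) t by (rule powr_mono)
    moreover have "t powr 1 \<le> t powr E" using E(1) t by (intro powr_mono) linarith+
    moreover have "t powr 1 = t" using t by simp
    ultimately show "t powr 2 \<le> C * t powr E" "t \<le> C * t powr E" by linarith+
  qed
  have C: "lw_const r = C" by (simp add: C_def)
  have dim: "10 * r - 2 = 2 * (2 * r + (3 * r - 1))" using r1 by simp
  note idx = append4_index[OF carriers]
  have "0 \<le> (x @\<^sub>v w @\<^sub>v s @\<^sub>v y) $ k \<and> (x @\<^sub>v w @\<^sub>v s @\<^sub>v y) $ k \<le> C * t powr E"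
    using k(1) unfolding dim
  proof (rule append4_cases)
    fix l assume l: "l < 2 * r" "k = l"
    have "x $ l \<le> C * t powr E"
      using l(1)
    proof (rule lw_col_cases)
      fix j assume j: "j < r"
      have h: "C / 2 * t powr E \<le> C * t powr E" using C_ge by simp
      have bd': "C / 2 * t powr e \<le> C * t powr E" if "e \<le> E" for e
        using bd[OF that] h powr_mono[OF that t] C_ge by (smt (verit) divide_le_cancel field_sum_of_halves mult_right_mono powr_ge_zero)
      show ?thesis if "l = 2 * j" using col_upper(1)[OF j] bd'[OF col(1)[OF j]] that by simp
      show ?thesis if "l = 2 * j + 1" using col_upper(2)[OF j] bd'[OF col(2)[OF j]] that by simp
    qed
    then show ?thesis using idx(2)[OF l(1)] pos(1)[OF l(1)] l(2) by simp
  next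
    fix l assume l: "l < 3 * r - 1" "k = 2 * r + l"
    have "w $ l \<le> C * t powr E"
      using l(1)
    proof (rule lw_row_cases)
      show ?thesis if "l = 0" using row_upper(1) bd0(1) that by simp
      show ?thesis if "l = 1" using row_upper(2) bd0(2) that by simp
      fix j assume j: "Suc j < r"
      then have ji: "j < i \<or> j = i" using ri by linarith
      show ?thesis if lj: "l = 3 * j + 2"
      proof -
        have "1 + odd_exp \<theta> j \<le> E" using ji row(1) S(1) k(2) l(2) lj by auto
        then show ?thesis using row_upper(3)[OF j] bd lj by force
      qed
      show ?thesis if lj: "l = 3 * j + 3"
      proof -
        have "1 + even_exp \<theta> j \<le> E" using ji row(2) S(2) k(2) l(2) lj by auto
        then show ?thesis using row_upper(4)[OF j] bd lj by force
      qed
      show ?thesis if lj: "l = 3 * j + 4"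
        unfolding lj using row_upper(5)[OF j] bd[OF col(2)[OF j]] by (rule order_trans)
    qed
    then show ?thesis using idx(3)[OF l(1)] pos(3)[OF l(1)] l(2) by simp
  next
    fix l assume l: "l < 2 * r" "k = 2 * r + (3 * r - 1) + l"
    show ?thesis using idx(4)[OF l(1)] pos(2)[OF l(1)] dual_upper(1)[OF l(1)] bd1 unfolding l(2) by simp
  next
    fix l assume l: "l < 3 * r - 1" "k = 2 * r + (3 * r - 1) + 2 * r + l"
    show ?thesis using idx(5)[OF l(1)] pos(4)[OF l(1)] dual_upper(2)[OF l(1)] bd1 unfolding l(2) by simp
  qed
  then show "0 \<le> lw_central_path r t (t powr \<theta>) $ k"
    "lw_central_path r t (t powr \<theta>) $ k \<le> lw_const r * t powr E"
    unfolding z C by auto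
qed

lemma lw_central_path_lower:
  assumes ri: "r = i + 2" and t: "t \<ge> 1" and \<theta>: "0 \<le> \<theta>" "\<theta> \<le> 2"
  shows "t powr (1 + odd_exp \<theta> i) / lw_const r \<le> lw_central_path r t (t powr \<theta>) $ (2 * r + (3 * i + 2))"
    "t powr (1 + even_exp \<theta> i) / lw_const r \<le> lw_central_path r t (t powr \<theta>) $ (2 * r + (3 * i + 3))"
proof -
  have r1: "r \<ge> 1" using ri by simp
  obtain x w s y where p: "lw_central_point r t \<theta> x w s y"
    and z: "lw_central_path r t (t powr \<theta>) = x @\<^sub>v w @\<^sub>v s @\<^sub>v y"
    using lw_central_point_exists[OF r1 t \<theta>] by blast
  interpret lw_central_point r t \<theta> x w s y by (rule p)
  have i: "Suc i < r" "3 * i + 2 < 3 * r - 1" "3 * i + 3 < 3 * r - 1" using ri by linarith+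
  have C: "lw_const r = C" "C > 0" using C_ge by (simp_all add: C_def)
  note idx = append4_index(3)[OF carriers]
  show "t powr (1 + odd_exp \<theta> i) / lw_const r \<le> lw_central_path r t (t powr \<theta>) $ (2 * r + (3 * i + 2))"
    unfolding z C(1) idx[OF i(2)] using row_lower(3)[OF i(1)] C(2) by (simp add: divide_le_eq mult.commute)
  show "t powr (1 + even_exp \<theta> i) / lw_const r \<le> lw_central_path r t (t powr \<theta>) $ (2 * r + (3 * i + 3))"
    unfolding z C(1) idx[OF i(3)] using row_lower(4)[OF i(1)] C(2) by (simp add: divide_le_eq mult.commute)
qed

text \<open>One step of the staircase: between two consecutive breakpoints of the zigzag, one of the two
  exponents at level \<open>i\<close> stays constant and the other one grows from \<open>\<delta>\<close> below to \<open>\<delta>\<close> above it. The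
  velocity then points in the direction of the slack of order \<open>t powr (1 + exponent)\<close>.\<close>

lemma lw_central_path_step:
  assumes r: "r = i + 2" "i \<ge> 1" and k: "k < 2 ^ i"
    and t: "t \<ge> 1" "t powr (1 / 2 ^ Suc i) \<ge> 20 * real r * (lw_const r)\<^sup>2"
  shows "concentrated (1 / (2 * real (10 * r - 2)))
    {if even k then 2 * r + (3 * i + 2) else 2 * r + (3 * i + 3)}
    (lw_central_path r t (t powr (2 * real (Suc k) / 2 ^ i)) - lw_central_path r t (t powr (2 * real k / 2 ^ i)))"
proof -
  define \<theta> \<theta>' where "\<theta> = 2 * real k / 2 ^ i" and "\<theta>' = 2 * real (Suc k) / 2 ^ i"
  define \<delta> where "\<delta> = (1::real) / 2 ^ i"
  define p where "p = (if even k then 2 * r + (3 * i + 2) else 2 * r + (3 * i + 3))"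
  let ?o = "odd_exp \<theta> i" and ?e = "even_exp \<theta> i" and ?o' = "odd_exp \<theta>' i" and ?e' = "even_exp \<theta>' i"
  define M where "M = max ?o ?e"
  \<comment> \<open>Halfway between the exponent \<open>1 + M\<close> of the slack that stays
    constant and the final exponent \<open>1 + M + \<delta>\<close> of the growing one. It is also
    the exponent of \<open>X (2 r)\<close> at the end of the step, so the margin \<delta> / 2 cannot
    be enlarged.\<close>
  define E where "E = 1 + M + \<delta> / 2"
  have r1: "r \<ge> 1" using r by simp
  have \<delta>: "\<delta> > 0" "\<delta> \<le> 1 / 2" "1 / 2 ^ Suc i = \<delta> / 2"
    using r(2) self_le_power[of "2::real" i] by (auto simp: \<delta>_def field_simps)
  have "real k \<le> 2 ^ i" "real (Suc k) \<le> 2 ^ i" using k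
    by (metis less_imp_le of_nat_le_iff of_nat_numeral of_nat_power,
      metis Suc_leI of_nat_le_iff of_nat_numeral of_nat_power)
  then have \<theta>: "0 \<le> \<theta>" "\<theta> \<le> 2" "0 \<le> \<theta>'" "\<theta>' \<le> 2" by (auto simp: \<theta>_def \<theta>'_def divide_le_eq)
  have "\<theta>' - \<theta> = 2 * \<delta>" by (simp add: \<theta>_def \<theta>'_def \<delta>_def field_simps)
  then have sum: "?o' + ?e' - (?o + ?e) = 2 * \<delta>" using exp_sum_diff by metis
  have diff: "?o - ?e = (if even k then - \<delta> else \<delta>)" "?o' - ?e' = (if even k then \<delta> else - \<delta>)"
    using exp_diff_breakpoint[of k i] exp_diff_breakpoint[of "Suc k" i] k
    unfolding \<theta>_def \<theta>'_def \<delta>_def by auto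
  have new: "if even k then ?o' = M + \<delta> \<and> ?e' = M else ?e' = M + \<delta> \<and> ?o' = M"
    using sum diff \<delta>(1) unfolding M_def by (auto split: if_splits)
  have M: "M \<ge> 3 / 2" unfolding M_def by (rule max_exp_ge[OF r(2)])
  have p: "p < 10 * r - 2" using r unfolding p_def by auto
  have "concentrated (1 / (2 * real (10 * r - 2))) {p}
    (lw_central_path r t (t powr \<theta>') - lw_central_path r t (t powr \<theta>))"
  proof (rule concentrated_diff[where L = "lw_const r * t powr E"
        and H = "t powr (1 + M + \<delta>) / lw_const r" and p = p])
    show "dim_vec (lw_central_path r t (t powr \<theta>)) = 10 * r - 2"
      "dim_vec (lw_central_path r t (t powr \<theta>')) = 10 * r - 2"
      using t(1) by (auto intro!: lw_central_path_dim[OF r1])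
    \<comment> \<open>At the left end both exponents at level \<open>i\<close> are at most
      \<open>M\<close>, so no coordinate has to be exempted. At the right end only \<open>p\<close>
      is.\<close>
    note old_le = lw_central_path_upper[OF r t(1) \<theta>(1,2), where E = E and S = "{}"]
    have old: "0 \<le> lw_central_path r t (t powr \<theta>) $ l \<and>
        lw_central_path r t (t powr \<theta>) $ l \<le> lw_const r * t powr E" if "l < 10 * r - 2" for l
      using old_le[of l] that M \<delta> unfolding E_def M_def by auto
    show "lw_central_path r t (t powr \<theta>) $ p \<le> lw_const r * t powr E" using old[OF p] by blast
    show "t powr (1 + M + \<delta>) / lw_const r \<le> lw_central_path r t (t powr \<theta>') $ p"
      using lw_central_path_lower[OF r(1) t(1) \<theta>(3,4)] new unfolding p_def
      by (auto simp: add.assoc split: if_splits)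
    fix l assume l: "l < 10 * r - 2" "l \<notin> {p}"
    show "0 \<le> lw_central_path r t (t powr \<theta>) $ l \<and>
        lw_central_path r t (t powr \<theta>) $ l \<le> lw_const r * t powr E \<and>
        0 \<le> lw_central_path r t (t powr \<theta>') $ l \<and>
        lw_central_path r t (t powr \<theta>') $ l \<le> lw_const r * t powr E"
      using old[OF l(1)] lw_central_path_upper[OF r t(1) \<theta>(3,4) _ _ _ _ _ l, of E] new M \<delta>
      unfolding E_def p_def by (auto split: if_splits)
  next
    show "p < 10 * r - 2" by (rule p)
    have C: "lw_const r > 0" using r1 by simp
    show "lw_const r * t powr E > 0" using C t(1) by simp
    \<comment> \<open>The dimension \<open>10 r - 2\<close> gives
      \<open>20 r - 3 \<le> 20 r\<close>. The constant occurs squared because it is lost once in the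
      upper bound \<open>L\<close> and once in the lower bound \<open>H\<close>.\<close>
    have "(1 + 2 * real (10 * r - 2)) * (lw_const r * t powr E) \<le> 20 * real r * (lw_const r * t powr E)"
      using C r1 by (intro mult_right_mono) (auto simp: of_nat_diff)
    also have "\<dots> = (20 * real r * (lw_const r)\<^sup>2) * t powr E / lw_const r"
      using C by (simp add: power2_eq_square)
    also have "\<dots> \<le> t powr (\<delta> / 2) * t powr E / lw_const r"
      using t(2) C unfolding \<delta>(3) by (intro divide_right_mono mult_right_mono) auto
    also have "\<dots> = t powr (1 + M + \<delta>) / lw_const r"
      by (simp add: E_def add_ac flip: powr_add)
    finally show "(1 + 2 * real (10 * r - 2)) * (lw_const r * t powr E) \<le> t powr (1 + M + \<delta>) / lw_const r" .
  qed
  then show ?thesis unfolding p_def \<theta>_def \<theta>'_def .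
qed

section \<open>Lower bounds for the total curvature\<close>

lemma lw_total_curvature_staircase:
  assumes r: "r \<ge> 3" and t: "t > 1" "t powr (1 / 2 ^ (r - 1)) \<ge> 20 * real r * (lw_const r)\<^sup>2"
  shows "total_curvature {0<..} (lw_central_path r t) \<ge> ereal (real (2 ^ (r - 2) - 1))"
proof -
  \<comment> \<open>Level \<open>r - 2\<close> is the last one whose two exponents appear separately
    in slacks. Its zigzag has \<open>2 ^ i\<close> pieces, hence \<open>2 ^ i - 1\<close> angles;
    consecutive supports are disjoint because the parity of \<open>k\<close> alternates.\<close>
  define i where "i = r - 2"
  have i: "r = i + 2" "i \<ge> 1" "r - 1 = Suc i" "r - 2 = i" using r by (auto simp: i_def)
  show ?thesis
    unfolding i(4)
  proof (rule total_curvature_ge[where T = "\<lambda>k. t powr (2 * real k / 2 ^ i)" and d = "10 * r - 2"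
        and S = "\<lambda>k. {if even k then 2 * r + (3 * i + 2) else 2 * r + (3 * i + 3)}"])
    show "t powr (2 * real k / 2 ^ i) < t powr (2 * real (Suc k) / 2 ^ i)" for k
      using t(1) by (simp add: divide_strict_right_mono)
    show "dim_vec (lw_central_path r t (t powr (2 * real k / 2 ^ i))) = 10 * r - 2" for k
      using r t(1) by (intro lw_central_path_dim) auto
    show "concentrated (1 / (2 * real (10 * r - 2)))
        {if even k then 2 * r + (3 * i + 2) else 2 * r + (3 * i + 3)}
        (lw_central_path r t (t powr (2 * real (Suc k) / 2 ^ i)) -
         lw_central_path r t (t powr (2 * real k / 2 ^ i)))" if "k < 2 ^ i" for k
      using t i by (intro lw_central_path_step that) auto
  qed (use t(1) in auto)
qed

text \<open>A further right angle, which does not need \<open>r\<close> to be large: up to \<open>\<mu> = t\<^sup>2\<close> it is mostly the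
  primal part that moves, and for \<open>\<mu> \<rightarrow> \<infinity>\<close> it is mostly the dual part.\<close>

lemma lw_total_curvature_ge_1:
  assumes r: "r \<ge> 1" and t: "t > 1" "t \<ge> 20 * real r * (lw_const r)\<^sup>2"
  shows "total_curvature {0<..} (lw_central_path r t) \<ge> ereal 1"
proof -
  define n m d where "n = 2 * r" and "m = 3 * r - 1" and "d = 10 * r - 2"
  define e where "e = 1 / (2 * real d)"
  \<comment> \<open>All primal coordinates are at most of order \<open>t powr (r + 2)\<close>, while
    the multiplier of \<open>X 2 \<le> t\<close> is at least \<open>\<mu> / t\<close>, since its
    slack is at most \<open>t\<close>. The exponent \<open>r + 4\<close> leaves one spare power of
    \<open>t\<close>.\<close>
  define \<mu> where "\<mu> = t powr (real r + 4)"
  let ?z = "lw_central_path r t"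
  have nm: "0 < n" "1 < n" "1 < m" "d = 2 * (n + m)"
    using r unfolding d_def n_def m_def by (linarith, linarith, linarith, simp)
  have t1: "t \<ge> 1" using t by simp
  obtain x0 w0 s0 y0 where p0: "lw_central_point r t 0 x0 w0 s0 y0"
    and z0: "?z (t powr 0) = x0 @\<^sub>v w0 @\<^sub>v s0 @\<^sub>v y0"
    by (rule lw_central_point_exists[OF r t1, of 0]) auto
  obtain x1 w1 s1 y1 where p1: "lw_central_point r t 2 x1 w1 s1 y1"
    and z1: "?z (t powr 2) = x1 @\<^sub>v w1 @\<^sub>v s1 @\<^sub>v y1"
    by (rule lw_central_point_exists[OF r t1, of 2]) auto
  have "\<mu> > 0" using t by (simp add: \<mu>_def)
  then obtain x2 w2 s2 y2 where sys2: "central_path_system (lw_A r t) (lw_b r t) (lw_c r) \<mu> x2 w2 s2 y2"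
    and z2: "?z \<mu> = x2 @\<^sub>v w2 @\<^sub>v s2 @\<^sub>v y2"
    by (rule lw_central_path_exists[OF r t1])
  interpret p0: lw_central_point r t 0 x0 w0 s0 y0 by (rule p0)
  interpret p1: lw_central_point r t 2 x1 w1 s1 y1 by (rule p1)
  define C where "C = lw_const r"
  have C: "p0.C = C" "p1.C = C" by (simp_all add: p0.C_def p1.C_def C_def)
  have C1: "C \<ge> 10" using p0.C_ge C by simp
  have c0: "x0 \<in> carrier_vec n" "w0 \<in> carrier_vec m" "s0 \<in> carrier_vec n" "y0 \<in> carrier_vec m"
    and c1: "x1 \<in> carrier_vec n" "w1 \<in> carrier_vec m" "s1 \<in> carrier_vec n" "y1 \<in> carrier_vec m"
    using p0.carriers p1.carriers unfolding n_def m_def by blast+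
  have c2: "x2 \<in> carrier_vec n" "w2 \<in> carrier_vec m" "s2 \<in> carrier_vec n" "y2 \<in> carrier_vec m"
    and primal2: "lw_A r t *\<^sub>v x2 + w2 = lw_b r t"
    and comp2: "\<And>i. i < m \<Longrightarrow> w2 $ i * y2 $ i = \<mu>"
    and pos2: "\<And>j. j < n \<Longrightarrow> x2 $ j > 0" "\<And>i. i < m \<Longrightarrow> w2 $ i > 0" "\<And>i. i < m \<Longrightarrow> y2 $ i > 0"
    using sys2 unfolding central_path_system_def n_def m_def by auto
  note idx0 = append4_index[OF c0, folded z0] and idx1 = append4_index[OF c1, folded z1]
    and idx2 = append4_index[OF c2, folded z2]
  have dims: "dim_vec (?z (t powr 0)) = d" "dim_vec (?z (t powr 2)) = d" "dim_vec (?z \<mu>) = d"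
    using idx0(1) idx1(1) idx2(1) nm(4) by auto
  have d1: "1 + 2 * real d \<le> 20 * real r" using r by (simp add: d_def of_nat_diff)
  have Ct: "C * t > 0" using C1 t by simp

  \<comment> \<open>Coordinate 0, that is \<open>X 1\<close>, grows from order 1 to order
    \<open>t ^ 2\<close>, while the dual coordinates, which occupy the indices from
    \<open>n + m\<close> on, have order at most \<open>t\<close> at both ends.\<close>
  have conc1: "concentrated e {..<n + m} (?z (t powr 2) - ?z (t powr 0))"
    unfolding e_def
  proof (rule concentrated_diff[where L = "C * t" and H = "t powr 2 / C" and p = 0])
    show "?z (t powr 0) $ 0 \<le> C * t"
    proof -
      have "x0 $ 0 \<le> C / 2" using p0.col_upper(1)[of 0] r t1 C by simp
      also have "C / 2 \<le> C" using C1 by simp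
      also have "C \<le> C * t" using C1 t1 by simp
      finally show ?thesis using idx0(2)[OF nm(1)] by simp
    qed
    show "t powr 2 / C \<le> ?z (t powr 2) $ 0"
      using p1.col_lower(1)[of 0] r C C1 idx1(2)[OF nm(1)] by (simp add: divide_le_eq mult.commute)
    fix k assume k: "k < d" "k \<notin> {..<n + m}"
    show "0 \<le> ?z (t powr 0) $ k \<and> ?z (t powr 0) $ k \<le> C * t \<and>
        0 \<le> ?z (t powr 2) $ k \<and> ?z (t powr 2) $ k \<le> C * t"
      using k(1) unfolding nm(4)
    proof (rule append4_cases)
      fix i assume i: "i < n" "k = n + m + i"
      then have i': "i < 2 * r" by (simp add: n_def)
      show ?thesis
        unfolding i(2) idx0(4)[OF i(1)] idx1(4)[OF i(1)]
        using p0.pos(2)[OF i'] p1.pos(2)[OF i'] p0.dual_upper(1)[OF i'] p1.dual_upper(1)[OF i'] C by simp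
    next
      fix i assume i: "i < m" "k = n + m + n + i"
      then have i': "i < 3 * r - 1" by (simp add: m_def)
      show ?thesis
        unfolding i(2) idx0(5)[OF i(1)] idx1(5)[OF i(1)]
        using p0.pos(4)[OF i'] p1.pos(4)[OF i'] p0.dual_upper(2)[OF i'] p1.dual_upper(2)[OF i'] C by simp
    qed (use k(2) in auto)
  next
    have "(1 + 2 * real d) * (C * t) \<le> 20 * real r * (C * t)"
      using d1 Ct by (intro mult_right_mono) auto
    also have "\<dots> = (20 * real r * C\<^sup>2) * t / C" using C1 by (simp add: power2_eq_square)
    also have "\<dots> \<le> t * t / C"
      using t C1 unfolding C_def by (intro divide_right_mono mult_right_mono) auto
    also have "\<dots> = t powr 2 / C" using t by (simp add: powr_numeral power2_eq_square)
    finally show "(1 + 2 * real d) * (C * t) \<le> t powr 2 / C" .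
  qed (use dims nm Ct in auto)

  define L where "L = C * t powr (real r + 2)"
  have "t powr 1 \<le> t powr (real r + 2)" using t1 by (intro powr_mono) auto
  then have CtL: "C * t \<le> L" unfolding L_def using C1 t by (intro mult_left_mono) auto
  have two: "2 * 2 ^ r \<le> C"
  proof -
    have "2 * 2 ^ r * 1 \<le> 10 * real r * 2 ^ r" using r by simp
    then show ?thesis by (simp add: C_def)
  qed
  have primal_le: "x $ j \<le> L" "w $ i \<le> L"
    if "x \<in> carrier_vec n" "w \<in> carrier_vec m" "lw_A r t *\<^sub>v x + w = lw_b r t"
      "\<And>j. j < n \<Longrightarrow> x $ j > 0" "\<And>i. i < m \<Longrightarrow> w $ i > 0" "j < n" "i < m" for x w i j
  proof -
    note B = lw_feasible_bounded[OF r _ _ that(3) _ _ t1, folded n_def m_def, OF that(1,2) less_imp_le[OF that(4)] less_imp_le[OF that(5)]]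
    have "x $ j \<le> 2 ^ r * t powr (real r + 1)" using B(1) that by blast
    also have "\<dots> \<le> L" unfolding L_def using two C1 t1 zero_le_power[of "2::real" r]
      by (intro mult_mono powr_mono) (linarith | simp)+
    finally show "x $ j \<le> L" .
    have "w $ i \<le> 2 ^ Suc r * t powr (real r + 2)" using B(2) that by blast
    also have "\<dots> \<le> L" unfolding L_def using two t1 by (intro mult_right_mono) auto
    finally show "w $ i \<le> L" .
  qed
  have pos1: "\<And>j. j < n \<Longrightarrow> x1 $ j > 0" "\<And>i. i < m \<Longrightarrow> w1 $ i > 0"
    using p1.pos unfolding n_def m_def by blast+
  \<comment> \<open>Index \<open>n + m + n + 1\<close> is the multiplier \<open>y $ 1\<close> of the
    bound \<open>X 2 \<le> t\<close>.\<close>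
  have conc2: "concentrated e {n + m..} (?z \<mu> - ?z (t powr 2))"
    unfolding e_def
  proof (rule concentrated_diff[where L = L and H = "t powr (real r + 3)" and p = "n + m + n + 1"])
    have m1: "1 < 3 * r - 1" using nm(3) by (simp add: m_def)
    show "?z (t powr 2) $ (n + m + n + 1) \<le> L"
      using p1.dual_upper(2)[OF m1] idx1(5)[OF nm(3)] CtL C by simp
    show "t powr (real r + 3) \<le> ?z \<mu> $ (n + m + n + 1)"
    proof -
      have "w2 $ 1 \<le> t"
        using lw_slack(2)[OF r c2(1,2)[unfolded n_def m_def] primal2] pos2(1)[OF nm(2)] by simp
      then have "w2 $ 1 * y2 $ 1 \<le> t * y2 $ 1" using pos2(3)[OF nm(3)] by (intro mult_right_mono) auto
      moreover have "\<mu> = t * t powr (real r + 3)"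
        using t powr_add[of t 1 "real r + 3"] by (simp add: \<mu>_def add.commute)
      ultimately have "t * t powr (real r + 3) \<le> t * y2 $ 1" using comp2[OF nm(3)] by simp
      then show ?thesis using t idx2(5)[OF nm(3)] by simp
    qed
    fix k assume k: "k < d" "k \<notin> {n + m..}"
    show "0 \<le> ?z (t powr 2) $ k \<and> ?z (t powr 2) $ k \<le> L \<and> 0 \<le> ?z \<mu> $ k \<and> ?z \<mu> $ k \<le> L"
      using k(1) unfolding nm(4)
    proof (rule append4_cases)
      fix i assume i: "i < n" "k = i"
      show ?thesis
        unfolding i(2) idx1(2)[OF i(1)] idx2(2)[OF i(1)]
        using primal_le(1)[OF c1(1,2) p1.primal pos1 i(1) nm(3)]
          primal_le(1)[OF c2(1,2) primal2 pos2(1,2) i(1) nm(3)] pos1(1)[OF i(1)] pos2(1)[OF i(1)] by simp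
    next
      fix i assume i: "i < m" "k = n + i"
      show ?thesis
        unfolding i(2) idx1(3)[OF i(1)] idx2(3)[OF i(1)]
        using primal_le(2)[OF c1(1,2) p1.primal pos1 nm(1) i(1)]
          primal_le(2)[OF c2(1,2) primal2 pos2(1,2) nm(1) i(1)] pos1(2)[OF i(1)] pos2(2)[OF i(1)] by simp
    qed (use k(2) in auto)
  next
    show "L > 0" using CtL Ct by linarith
    have "(1 + 2 * real d) * L \<le> 20 * real r * L"
      using d1 CtL Ct by (intro mult_right_mono) auto
    also have "\<dots> = (20 * real r * C) * t powr (real r + 2)" by (simp add: L_def)
    also have "\<dots> \<le> (20 * real r * C\<^sup>2) * t powr (real r + 2)"
      using C1 by (intro mult_right_mono mult_left_mono) (auto simp: power2_eq_square)
    also have "\<dots> \<le> t * t powr (real r + 2)"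
      using t unfolding C_def by (intro mult_right_mono) auto
    also have "\<dots> = t powr (real r + 3)" using t powr_add[of t 1 "real r + 2"] by (simp add: add.commute)
    finally show "(1 + 2 * real d) * L \<le> t powr (real r + 3)" .
  qed (use dims nm in auto)

  define T where "T = (\<lambda>k::nat. if k = 0 then t powr 0 else if k = 1 then t powr 2 else \<mu>)"
  define S where "S = (\<lambda>k::nat. if k = 0 then {..<n + m} else {n + m..})"
  have "ereal (real (2 - 1)) \<le> total_curvature {0<..} ?z"
  proof (rule total_curvature_ge[where T = T and S = S and d = d])
    show "T k < T (Suc k)" if "k < 2" for k
    proof -
      have "t powr 0 < t powr 2" using t by (intro powr_less_mono) auto
      moreover have "t powr 2 < \<mu>" unfolding \<mu>_def using t r by (intro powr_less_mono) auto
      moreover have "k = 0 \<or> k = 1" using that by auto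
      ultimately show ?thesis unfolding T_def by auto
    qed
    show "concentrated (1 / (2 * real d)) (S k) (?z (T (Suc k)) - ?z (T k))" if "k < 2" for k
    proof -
      have "k = 0 \<or> k = 1" using that by auto
      then show ?thesis using conc1 conc2 unfolding T_def S_def e_def by auto
    qed
  qed (use dims t \<open>\<mu> > 0\<close> in \<open>auto simp: T_def S_def\<close>)
  then show ?thesis by simp
qed

theorem theorem1:
  shows "\<exists>c>0. \<exists>a>1. \<forall>r\<ge>1. \<exists>t\<^sub>0>0. \<forall>t\<ge>t\<^sub>0.
           total_curvature {0<..} (lw_central_path r t) \<ge> ereal (c * a ^ r)"
proof (rule exI[of _ "1 / 8"], rule conjI, simp, rule exI[of _ 2], rule conjI, simp, intro allI impI)
  fix r :: nat assume r: "r \<ge> 1"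
  define K where "K = max 2 (20 * real r * (lw_const r)\<^sup>2)"
  \<comment> \<open>Chosen so that its root of order \<open>2 ^ (r - 1)\<close> is \<open>K\<close>,
    the margin demanded by the staircase.\<close>
  define t0 where "t0 = K powr (2 ^ (r - 1))"
  have K: "K \<ge> 2" "K \<ge> 20 * real r * (lw_const r)\<^sup>2" by (simp_all add: K_def)
  show "\<exists>t\<^sub>0>0. \<forall>t\<ge>t\<^sub>0. total_curvature {0<..} (lw_central_path r t) \<ge> ereal (1 / 8 * 2 ^ r)"
  proof (intro exI[of _ t0] conjI allI impI)
    show "t0 > 0" using K by (simp add: t0_def)
    fix t assume t: "t \<ge> t0"
    have "K powr 1 \<le> t0" unfolding t0_def using K by (intro powr_mono) auto
    then have tK: "t \<ge> K" using t K by simp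
    show "total_curvature {0<..} (lw_central_path r t) \<ge> ereal (1 / 8 * 2 ^ r)"
    \<comment> \<open>From \<open>r = 3\<close> on,
      \<open>2 ^ (r - 2) - 1 \<ge> 2 ^ (r - 3)\<close>, which is the origin of the factor 1/8. For
      \<open>r \<le> 2\<close> the target is at most 1/2 and the single primal-dual turn is
      enough.\<close>
    proof (cases "r \<ge> 3")
      case True
      then obtain j where j: "r = j + 3" by (metis add.commute le_Suc_ex)
      have "K = t0 powr (1 / 2 ^ (r - 1))" using K by (simp add: t0_def powr_powr)
      also have "\<dots> \<le> t powr (1 / 2 ^ (r - 1))" using t K by (intro powr_mono2) (auto simp: t0_def)
      finally have "t powr (1 / 2 ^ (r - 1)) \<ge> 20 * real r * (lw_const r)\<^sup>2" using K by linarith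
      then have "ereal (real (2 ^ (r - 2) - 1)) \<le> total_curvature {0<..} (lw_central_path r t)"
        using lw_total_curvature_staircase[OF True] tK K by simp
      moreover have "1 / 8 * 2 ^ r \<le> real (2 ^ (r - 2) - 1)"
        using one_le_power[of "2::real" j] by (simp add: j of_nat_diff power_add)
      ultimately show ?thesis by (meson ereal_less_eq(3) order_trans)
    next
      case False
      then have "(2::real) ^ r \<le> 2 ^ 2" by (intro power_increasing) auto
      then have "1 / 8 * 2 ^ r \<le> (1::real)" by simp
      moreover have "ereal 1 \<le> total_curvature {0<..} (lw_central_path r t)"
        using lw_total_curvature_ge_1[OF r] tK K by simp
      ultimately show ?thesis by (meson ereal_less_eq(3) order_trans)
    qed
  qed
qed

end
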